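(* Let $n\ge 1$, let $\alpha < 0$ be real, and let $p \in \mathbb{C}[z_1,\ldots,z_n]$ be an atoral polynomial with no zeros in $\mathbb{D}^n$ and with only one zero on the boundary of $\mathbb{D}^n$, this zero being the point $(1,\ldots,1)$. If there exist a real number $$q < \frac{1-\alpha}{2}\, n$$ and a constant $C > 0$ such that $$|p(z)| \geq C\, \mathrm{dist}(z, (1,\ldots,1))^q \quad \text{for all } z \in \mathbb{D}^n,$$ then $\tilde{p}/p \in \mathcal{D}_{\alpha + 2/n}(\mathbb{D}^n)$.
   Context: $\mathbb{D}^n = \{z \in \mathbb{C}^n : |z_j| < 1,\ j = 1,\ldots,n\}$ is the unit polydisc, and $\mathrm{dist}$ is the Euclidean distance in $\mathbb{C}^n$. For a polynomial $p$ of multi-degree $(d_1,\ldots,d_n)$ (i.e. of degree $d_j$ in $z_j$), its reflection is the polynomial $\tilde{p}(z) = z_1^{d_1}\cdots z_n^{d_n}\, \overline{p(1/\overline{z_1},\ldots,1/\overline{z_n})}$. "Atoral" means here: $p$ is not constant in any of the variables $z_1,\ldots,z_n$, and $p$ and $\tilde p$ have no common factors. For a scalar $\beta \in \mathbb{R}$, $\mathcal{D}_\beta(\mathbb{D}^n) = \mathcal{D}_{\beta,\ldots,\beta}(\mathbb{D}^n)$ is the set of holomorphic $f(z) = \sum_{k \in \mathbb{N}^n} \hat f(k) z^k$ on $\mathbb{D}^n$ (with $0\in\mathbb{N}$) such that $\sum_{k \in \mathbb{N}^n} (1+k_1)^{\beta}\cdots(1+k_n)^{\beta} |\hat f(k)|^2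 < \infty$. *)

theory Defs
  imports "HOL-Analysis.Analysis" "HOL-Library.Poly_Mapping"
begin

text \<open>
  The number of variables is the cardinality of the finite index type \<open>'n\<close>.  Multi-indices are
  vectors \<open>nat ^ 'n\<close>, and polynomials are finitely supported maps from multi-indices to
  coefficients; \<open>+\<close>, \<open>*\<close>, \<open>1\<close> and \<open>dvd\<close> on this type are those of the polynomial ring.
\<close>

type_synonym 'n mpoly = "(nat ^ 'n) \<Rightarrow>\<^sub>0 complex"

definition monom_eval :: "nat ^ 'n \<Rightarrow> complex ^ 'n \<Rightarrow> complex" where
  "monom_eval k z = (\<Prod>j\<in>UNIV. z $ j ^ (k $ j))"

definition eval_poly :: "'n::finite mpoly \<Rightarrow> complex ^ 'n \<Rightarrow> complex" where
  "eval_poly p z = (\<Sum>k\<in>Poly_Mapping.keys p. Poly_Mapping.lookup p k * monom_eval k z)"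

text \<open>The inserted \<open>0\<close> only matters for the zero polynomial.\<close>

definition multidegree :: "'n::finite mpoly \<Rightarrow> nat ^ 'n" where
  "multidegree p = (\<chi> j. Max (insert 0 ((\<lambda>k. k $ j) ` Poly_Mapping.keys p)))"

text \<open>
  The identity \<open>z\<^sup>d * cnj (p (1 / cnj z))\<close> makes sense pointwise only where no coordinate of \<open>z\<close>
  vanishes; the polynomial it determines is obtained by conjugating each coefficient and replacing
  each exponent \<open>k\<close> by \<open>d - k\<close>.  The lemma \<open>eval_poly_reflection\<close> below recovers the identity.
\<close>

definition reflection :: "'n::finite mpoly \<Rightarrow> 'n mpoly" where
  "reflection p = (\<Sum>k\<in>Poly_Mapping.keys p. Poly_Mapping.single (multidegree p - k) (cnj (Poly_Mapping.lookup p k)))"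

text \<open>
  The divisors of \<open>1\<close> in the polynomial ring are the nonzero constants.  The library constant
  \<open>coprime\<close> is not available here, since the type is not an instance of its type class.
\<close>

definition atoral :: "'n::finite mpoly \<Rightarrow> bool" where
  "atoral p \<longleftrightarrow> (\<forall>j. multidegree p $ j \<noteq> 0) \<and>
     (\<forall>g. g dvd p \<longrightarrow> g dvd reflection p \<longrightarrow> g dvd 1)"

definition polydisc :: "(complex ^ 'n) set" where
  "polydisc = {z. \<forall>j. norm (z $ j) < 1}"

definition holomorphic_several :: "(complex ^ 'n::finite \<Rightarrow> complex) \<Rightarrow> (complex ^ 'n) set \<Rightarrow> bool" where
  "holomorphic_several f S \<longleftrightarrow>
     (\<forall>z\<in>S. \<exists>f'. (f has_derivative f') (at z within S) \<and> (\<forall>c v. f' (c *s v) = c * f' v))"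

text \<open>
  Functions on the polydisc are represented by total functions whose values outside the polydisc
  are irrelevant.  The coefficients \<open>c\<close> are uniquely determined by \<open>f\<close> on the polydisc.
\<close>

definition dirichlet_space :: "real \<Rightarrow> (complex ^ 'n::finite \<Rightarrow> complex) set" where
  "dirichlet_space \<beta> = {f. holomorphic_several f polydisc \<and>
     (\<exists>c :: nat ^ 'n \<Rightarrow> complex.
        (\<forall>z\<in>polydisc. ((\<lambda>k. c k * monom_eval k z) has_sum f z) UNIV) \<and>
        (\<lambda>k. (\<Prod>j\<in>UNIV. (1 + real (k $ j)) powr \<beta>) * (norm (c k))\<^sup>2) summable_on UNIV)}"

lemma le_multidegree:
  assumes "k \<in> Poly_Mapping.keys p"
  shows "k $ j \<le> multidegree p $ j"
  unfolding multidegree_def using assms by (auto intro!: Max_ge)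

lemma eval_poly_superset:
  assumes "finite S" "Poly_Mapping.keys p \<subseteq> S"
  shows "eval_poly p z = (\<Sum>k\<in>S. Poly_Mapping.lookup p k * monom_eval k z)"
  unfolding eval_poly_def
  by (rule sum.mono_neutral_left) (use assms in \<open>auto simp: in_keys_iff\<close>)

lemma eval_poly_add: "eval_poly (p + q) z = eval_poly p z + eval_poly q z"
proof -
  let ?S = "Poly_Mapping.keys p \<union> Poly_Mapping.keys q"
  have "Poly_Mapping.keys (p + q) \<subseteq> ?S" by (rule Poly_Mapping.keys_add)
  then show ?thesis
    by (simp add: eval_poly_superset[of ?S] lookup_add distrib_right sum.distrib)
qed

lemma eval_poly_single: "eval_poly (Poly_Mapping.single k a) z = a * monom_eval k z"
  by (simp add: eval_poly_def)

lemma eval_poly_sum: "eval_poly (\<Sum>i\<in>I. f i) z = (\<Sum>i\<in>I. eval_poly (f i) z)"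
proof (induction I rule: infinite_finite_induct)
  case (insert i I)
  then show ?case by (simp add: eval_poly_add)
qed (simp_all add: eval_poly_def)

lemma eval_poly_reflection:
  fixes p :: "'n::finite mpoly"
  assumes "\<And>j. z $ j \<noteq> 0"
  shows "eval_poly (reflection p) z =
    monom_eval (multidegree p) z * cnj (eval_poly p (\<chi> j. 1 / cnj (z $ j)))"
proof -
  have "monom_eval (multidegree p - k) z =
      monom_eval (multidegree p) z * cnj (monom_eval k (\<chi> j. 1 / cnj (z $ j)))"
    if "k \<in> Poly_Mapping.keys p" for k
    using assms le_multidegree[OF that]
    by (simp add: monom_eval_def prod.distrib[symmetric] power_diff power_divide)
  then show ?thesis
    unfolding reflection_def eval_poly_sum eval_poly_single
    by (simp add: eval_poly_def sum_distrib_left mult_ac)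
qed

end

theory Submission
  imports Defs "HOL-Complex_Analysis.Complex_Analysis"
begin

text \<open>
  Write \<open>\<phi>\<close> for the quotient of the reflection by \<open>p\<close>; the maximum principle gives \<open>\<bar>\<phi>\<bar> \<le> 1\<close> on the
  polydisc.  Expanding the slices \<open>t \<mapsto> \<phi> (t z)\<close> yields the power series \<open>\<phi> = \<Sum> c\<^sub>k z\<^sup>k\<close>, and
  \<open>g z = d/dt (t \<phi> (t z))\<close> at \<open>t = 1\<close> has the coefficients \<open>a\<^sub>k = (1 + \<bar>k\<bar>) c\<^sub>k\<close>.  By the quotient rule
  \<open>\<bar>g\<bar> \<le> K / \<bar>p\<bar>\<close>, so the lower bound on \<open>\<bar>p\<bar>\<close> gives \<open>\<bar>g z\<bar> \<le> L \<Prod>\<^sub>j \<bar>1 - z\<^sub>j\<bar>\<^bsup>-s/2\<^esup>\<close> for some \<open>s\<close> with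
  \<open>1 < s < 1 - \<alpha>\<close>.  Comparing mean squares over tori of radii \<open>r\<close> with the binomial series of the
  right-hand side gives \<open>\<Sum> \<bar>a\<^sub>k\<bar>\<^sup>2 r\<^bsup>2k\<^esup> \<le> M \<Prod>\<^sub>j (1 - r\<^sub>j)\<^bsup>1-s\<^esup>\<close>, and a dyadic decomposition of the
  multi-indices turns this into \<open>\<Sum> \<Prod>\<^sub>j (1 + k\<^sub>j)\<^bsup>\<alpha>\<^esup> \<bar>a\<^sub>k\<bar>\<^sup>2 < \<infinity>\<close>.  It remains to observe that
  \<open>\<Prod>\<^sub>j (1 + k\<^sub>j)\<^bsup>2/n\<^esup> \<le> (1 + \<bar>k\<bar>)\<^sup>2\<close>.
\<close>

no_notation fps_nth (infixl \<open>$\<close> 75)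

subsection \<open>Multi-indices and Parseval's identity for roots of unity\<close>

lemma bij_vec_lambda: "bij (vec_lambda :: ('n \<Rightarrow> 'a) \<Rightarrow> 'a ^ 'n)"
  by (rule o_bij[of vec_nth]) (auto simp: fun_eq_iff vec_eq_iff)

definition index_box :: "nat \<Rightarrow> (nat ^ 'n) set" where
  "index_box N = {k. \<forall>j. k $ j < N}"

lemma bij_betw_box:
  "bij_betw vec_lambda (PiE UNIV (\<lambda>_::'n. {..<N})) (index_box N :: (nat ^ 'n) set)"
  by (rule bij_betwI[of _ _ _ vec_nth]) (auto simp: index_box_def PiE_UNIV_domain)

lemma finite_box [simp, intro]: "finite (index_box N :: (nat ^ 'n::finite) set)"
  by (subst bij_betw_finite[OF bij_betw_box, symmetric]) (rule finite_PiE, auto)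

lemma sum_prod_box:
  fixes f :: "'n::finite \<Rightarrow> nat \<Rightarrow> 'a::comm_semiring_1"
  shows "(\<Sum>k\<in>index_box N. \<Prod>j\<in>UNIV. f j (k $ j)) = (\<Prod>j\<in>UNIV. \<Sum>i<N. f j i)"
  by (subst sum.reindex_bij_betw[OF bij_betw_box, symmetric]) (simp add: prod_sum_PiE)

lemma card_box: "card (index_box N :: (nat ^ 'n::finite) set) = N ^ CARD('n)"
  using sum_prod_box[of "\<lambda>(_::'n) _. 1::nat" N] by simp

lemma finite_subset_box:
  fixes F :: "(nat ^ 'n::finite) set"
  assumes "finite F"
  obtains N where "F \<subseteq> index_box N" "N > 0"
proof
  let ?N = "Suc (\<Sum>k\<in>F. \<Sum>j\<in>UNIV. k $ j)"
  show "F \<subseteq> index_box ?N"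
  proof (clarsimp simp: index_box_def)
    fix k j assume "k \<in> F"
    have "k $ j \<le> (\<Sum>j\<in>UNIV. k $ j)" by (rule member_le_sum) auto
    also have "\<dots> \<le> (\<Sum>k\<in>F. \<Sum>j\<in>UNIV. k $ j)"
      using \<open>k \<in> F\<close> assms by (intro member_le_sum) auto
    finally show "k $ j < ?N" by simp
  qed
qed simp

lemma abs_summable_prod:
  fixes f :: "'n::finite \<Rightarrow> nat \<Rightarrow> 'a::{real_normed_field}"
  assumes "\<And>j. (\<lambda>i. norm (f j i)) summable_on UNIV"
  shows "(\<lambda>k::nat ^ 'n. norm (\<Prod>j\<in>UNIV. f j (k $ j))) summable_on UNIV"
proof (rule nonneg_bdd_above_summable_on)
  show "bdd_above (sum (\<lambda>k::nat ^ 'n. norm (\<Prod>j\<in>UNIV. f j (k $ j))) ` {F. F \<subseteq> UNIV \<and> finite F})"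
  proof (rule bdd_aboveI2)
    fix F :: "(nat ^ 'n) set"
    assume "F \<in> {F. F \<subseteq> UNIV \<and> finite F}"
    then obtain N where "F \<subseteq> index_box N" using finite_subset_box by blast
    then have "(\<Sum>k\<in>F. norm (\<Prod>j\<in>UNIV. f j (k $ j))) \<le> (\<Sum>k\<in>index_box N. norm (\<Prod>j\<in>UNIV. f j (k $ j)))"
      by (intro sum_mono2) auto
    also have "\<dots> = (\<Prod>j\<in>UNIV. \<Sum>i<N. norm (f j i))"
      by (simp only: prod_norm[symmetric]) (rule sum_prod_box)
    also have "\<dots> \<le> (\<Prod>j\<in>UNIV. infsum (\<lambda>i. norm (f j i)) UNIV)"
      using assms by (intro prod_mono) (auto intro!: finite_sum_le_infsum sum_nonneg)
    finally show "(\<Sum>k\<in>F. norm (\<Prod>j\<in>UNIV. f j (k $ j))) \<le> (\<Prod>j\<in>UNIV. infsum (\<lambda>i. norm (f j i)) UNIV)" .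
  qed
qed auto

lemma infsum_prod:
  fixes f :: "'n::finite \<Rightarrow> nat \<Rightarrow> 'a::{banach, real_normed_field}"
  assumes "\<And>j. (\<lambda>i. norm (f j i)) summable_on UNIV"
  shows "infsum (\<lambda>k::nat ^ 'n. \<Prod>j\<in>UNIV. f j (k $ j)) UNIV = (\<Prod>j\<in>UNIV. infsum (f j) UNIV)"
proof -
  have "infsum (\<lambda>k::nat ^ 'n. \<Prod>j\<in>UNIV. f j (k $ j)) UNIV =
      infsum (\<lambda>x. \<Prod>j\<in>UNIV. f j (x j)) (PiE UNIV (\<lambda>_. UNIV))"
    using infsum_reindex_bij_betw[OF bij_vec_lambda, of "\<lambda>k::nat ^ 'n. \<Prod>j\<in>UNIV. f j (k $ j)"]
    by simp
  also have "\<dots> = (\<Prod>j\<in>UNIV. infsum (f j) UNIV)"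
    using assms by (intro infsum_prod_PiE_abs) auto
  finally show ?thesis .
qed

definition root_vec :: "nat \<Rightarrow> nat ^ 'n \<Rightarrow> complex ^ 'n" where
  "root_vec N x = (\<chi> j. cis (2 * pi * real (x $ j) / real N))"

lemma norm_root_vec [simp]: "norm (root_vec N x $ j) = 1"
  by (simp add: root_vec_def)

lemma sum_roots_orthogonal:
  fixes k l :: nat
  assumes "k < N" "l < N"
  shows "(\<Sum>i<N. cis (2 * pi * real i / real N) ^ k * cnj (cis (2 * pi * real i / real N) ^ l)) =
    (if k = l then of_nat N else 0)"
proof -
  define w where "w = cis (2 * pi * (real k - real l) / real N)"
  have eq: "cis (2 * pi * real i / real N) ^ k * cnj (cis (2 * pi * real i / real N) ^ l) = w ^ i" for i
    by (simp add: w_def Complex.DeMoivre cis_cnj cis_mult) (simp add: algebra_simps diff_divide_distrib)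
  show ?thesis
  proof (cases "k = l")
    case True
    then show ?thesis unfolding eq by (simp add: w_def)
  next
    case False
    have "w \<noteq> 1"
    proof
      assume "w = 1"
      then have "cos (2 * pi * (real k - real l) / real N) = 1" by (simp add: w_def complex_eq_iff)
      then obtain n :: int where "2 * pi * (real k - real l) / real N = real_of_int n * 2 * pi"
        by (auto simp: cos_one_2pi_int)
      then have "(2 * pi) * (real k - real l) = (2 * pi) * (real_of_int n * real N)"
        using assms by (simp add: field_simps)
      then have "real_of_int (int k - int l) = real_of_int (n * int N)" by simp
      then have *: "int k - int l = n * int N" by linarith
      then have "int N dvd int k - int l" by simp
      then have "int k mod int N = int l mod int N" by (simp add: mod_eq_dvd_iff)
      with assms False show False by simp
    qed
    moreover have "w ^ N = 1"
      using assms cis_multiple_2pi[of "real k - real l"]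
      by (simp add: w_def Complex.DeMoivre mult.assoc)
    ultimately show ?thesis unfolding eq using False by (simp add: geometric_sum)
  qed
qed

lemma sum_monom_orthogonal:
  fixes k l :: "nat ^ 'n::finite"
  assumes "k \<in> index_box N" "l \<in> index_box N"
  shows "(\<Sum>x\<in>index_box N. monom_eval k (root_vec N x) * cnj (monom_eval l (root_vec N x))) =
    (if k = l then of_nat N ^ CARD('n) else 0)"
proof -
  have "(\<Sum>x\<in>index_box N. monom_eval k (root_vec N x) * cnj (monom_eval l (root_vec N x))) =
     (\<Prod>j\<in>UNIV. \<Sum>i<N. cis (2 * pi * real i / real N) ^ (k $ j) * cnj (cis (2 * pi * real i / real N) ^ (l $ j)))"
    unfolding sum_prod_box[symmetric] by (simp add: monom_eval_def root_vec_def prod.distrib)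
  also have "\<dots> = (\<Prod>j\<in>UNIV. if k $ j = l $ j then of_nat N else 0)"
    using assms by (intro prod.cong refl sum_roots_orthogonal) (auto simp: index_box_def)
  also have "\<dots> = (if k = l then of_nat N ^ CARD('n) else 0)"
    by (auto simp: vec_eq_iff)
  finally show ?thesis .
qed

lemma discrete_parseval:
  fixes a :: "nat ^ 'n::finite \<Rightarrow> complex"
  assumes "F \<subseteq> index_box N"
  shows "(\<Sum>x\<in>index_box N. (norm (\<Sum>k\<in>F. a k * monom_eval k (root_vec N x)))\<^sup>2) =
    real N ^ CARD('n) * (\<Sum>k\<in>F. (norm (a k))\<^sup>2)"
proof -
  have fin: "finite F" using assms finite_subset by blast
  let ?e = "\<lambda>k x. monom_eval k (root_vec N x)"
  have "complex_of_real (\<Sum>x\<in>index_box N. (norm (\<Sum>k\<in>F. a k * ?e k x))\<^sup>2) =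
      (\<Sum>x\<in>index_box N. \<Sum>k\<in>F. \<Sum>l\<in>F. a k * cnj (a l) * (?e k x * cnj (?e l x)))"
    by (simp add: complex_norm_square sum_product mult_ac del: of_real_power)
  also have "\<dots> = (\<Sum>k\<in>F. \<Sum>l\<in>F. \<Sum>x\<in>index_box N. a k * cnj (a l) * (?e k x * cnj (?e l x)))"
    by (subst sum.swap, rule sum.cong[OF refl], subst sum.swap, rule refl)
  also have "\<dots> = (\<Sum>k\<in>F. \<Sum>l\<in>F. a k * cnj (a l) * (if k = l then of_nat N ^ CARD('n) else 0))"
    using assms by (intro sum.cong refl, subst sum_distrib_left[symmetric], subst sum_monom_orthogonal) auto
  also have "\<dots> = (\<Sum>k\<in>F. a k * cnj (a k) * of_nat N ^ CARD('n))"
    using fin by (intro sum.cong refl) (simp add: if_distrib sum.delta' cong: if_cong)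
  also have "\<dots> = complex_of_real (real N ^ CARD('n) * (\<Sum>k\<in>F. (norm (a k))\<^sup>2))"
    
    by (simp only: of_real_mult of_real_sum complex_norm_square sum_distrib_left) (simp add: mult_ac)
  finally show ?thesis unfolding of_real_eq_iff .
qed

lemma norm_monom_eval_torus:
  assumes "\<And>j. norm (w $ j) = 1"
  shows "norm (monom_eval k (w :: complex ^ 'n::finite)) = 1"
  using assms by (simp add: monom_eval_def prod_norm[symmetric] norm_power)

lemma norm_infsum_minus_sum_le:
  fixes f :: "'a \<Rightarrow> complex"
  assumes "(\<lambda>k. norm (f k)) summable_on UNIV" "finite G"
  shows "norm (infsum f UNIV - sum f G) \<le> infsum (\<lambda>k. norm (f k)) UNIV - (\<Sum>k\<in>G. norm (f k))"
proof -
  have s: "f summable_on UNIV" by (rule abs_summable_summable) fact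
  have "infsum f UNIV - sum f G = infsum f (UNIV - G)"
    using infsum_Diff[OF s summable_on_finite[OF assms(2)]] assms(2) by simp
  also have "norm \<dots> \<le> infsum (\<lambda>k. norm (f k)) (UNIV - G)"
    by (rule norm_infsum_bound) (rule summable_on_subset_banach[OF assms(1)], simp)
  also have "\<dots> = infsum (\<lambda>k. norm (f k)) UNIV - (\<Sum>k\<in>G. norm (f k))"
    using infsum_Diff[OF assms(1) summable_on_finite[OF assms(2)]] assms(2) by simp
  finally show ?thesis .
qed

lemma summable_norm_square:
  fixes b :: "'a \<Rightarrow> complex"
  assumes "(\<lambda>k. norm (b k)) summable_on UNIV"
  shows "(\<lambda>k. (norm (b k))\<^sup>2) summable_on UNIV"
proof (rule summable_on_comparison_test)
  let ?M = "infsum (\<lambda>k. norm (b k)) UNIV"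
  show "(\<lambda>k. ?M * norm (b k)) summable_on UNIV"
    using assms by (rule summable_on_cmult_right)
  have "norm (b k) \<le> ?M" for k
    using finite_sum_le_infsum[OF assms, of "{k}"] by simp
  then show "(norm (b k))\<^sup>2 \<le> ?M * norm (b k)" for k
    by (simp add: power2_eq_square mult_right_mono)
qed simp

lemma parseval_mono:
  fixes a b :: "nat ^ 'n::finite \<Rightarrow> complex"
  assumes a: "(\<lambda>k. norm (a k)) summable_on UNIV" and b: "(\<lambda>k. norm (b k)) summable_on UNIV"
    and le: "\<And>w. (\<And>j. norm (w $ j) = 1) \<Longrightarrow>
      norm (infsum (\<lambda>k. a k * monom_eval k w) UNIV) \<le> norm (infsum (\<lambda>k. b k * monom_eval k w) UNIV)"
    and F: "finite F"
  shows "(\<Sum>k\<in>F. (norm (a k))\<^sup>2) \<le> infsum (\<lambda>k. (norm (b k))\<^sup>2) UNIV"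
proof (rule tendsto_lowerbound)
  define M where "M = infsum (\<lambda>k. norm (b k)) UNIV"
  define d where "d G = (infsum (\<lambda>k. norm (a k)) UNIV - (\<Sum>k\<in>G. norm (a k))) + (M - (\<Sum>k\<in>G. norm (b k)))" for G
  have "(sum (\<lambda>k. norm (a k)) \<longlongrightarrow> infsum (\<lambda>k. norm (a k)) UNIV) (finite_subsets_at_top UNIV)"
    "(sum (\<lambda>k. norm (b k)) \<longlongrightarrow> M) (finite_subsets_at_top UNIV)"
    "(sum (\<lambda>k. (norm (b k))\<^sup>2) \<longlongrightarrow> infsum (\<lambda>k. (norm (b k))\<^sup>2) UNIV) (finite_subsets_at_top UNIV)"
    unfolding M_def using a b summable_norm_square[OF b] by (auto simp: has_sum_def[symmetric])
  note lim = this
  have d0: "(d \<longlongrightarrow> 0) (finite_subsets_at_top UNIV)"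
    unfolding d_def using lim by (auto intro!: tendsto_eq_intros)
  show "((\<lambda>G. (\<Sum>k\<in>G. (norm (b k))\<^sup>2) + (2 * M * d G + (d G)\<^sup>2)) \<longlongrightarrow> infsum (\<lambda>k. (norm (b k))\<^sup>2) UNIV)
      (finite_subsets_at_top UNIV)"
    using lim(3) d0 by (auto intro!: tendsto_eq_intros)
  have key: "(\<Sum>k\<in>F. (norm (a k))\<^sup>2) \<le> (\<Sum>k\<in>G. (norm (b k))\<^sup>2) + (2 * M * d G + (d G)\<^sup>2)"
    if G: "finite G" "F \<subseteq> G" for G
  proof -
    obtain N where N: "G \<subseteq> index_box N" "N > 0" using finite_subset_box[OF G(1)] by blast
    define S where "S c x = norm (\<Sum>k\<in>G. c k * monom_eval k (root_vec N x))" for c and x :: "nat ^ 'n"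
    have le: "(S a x)\<^sup>2 \<le> (S b x)\<^sup>2 + (2 * M * d G + (d G)\<^sup>2)" for x
    proof -
      let ?e = "\<lambda>k. monom_eval k (root_vec N x)"
      have e [simp]: "norm (?e k) = 1" for k by (rule norm_monom_eval_torus) simp
      have "norm (infsum (\<lambda>k. a k * ?e k) UNIV - (\<Sum>k\<in>G. a k * ?e k)) \<le>
          infsum (\<lambda>k. norm (a k)) UNIV - (\<Sum>k\<in>G. norm (a k))"
        using norm_infsum_minus_sum_le[of "\<lambda>k. a k * ?e k" G] a G by (simp add: norm_mult)
      moreover have "norm (infsum (\<lambda>k. b k * ?e k) UNIV - (\<Sum>k\<in>G. b k * ?e k)) \<le>
          M - (\<Sum>k\<in>G. norm (b k))"
        using norm_infsum_minus_sum_le[of "\<lambda>k. b k * ?e k" G] b G by (simp add: norm_mult M_def)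
      moreover have "norm (infsum (\<lambda>k. a k * ?e k) UNIV) \<le> norm (infsum (\<lambda>k. b k * ?e k) UNIV)"
        by (rule assms(3)) simp
      ultimately have 1: "S a x \<le> S b x + d G"
        unfolding S_def d_def by norm
      have "S b x \<le> (\<Sum>k\<in>G. norm (b k))"
        unfolding S_def by (rule order_trans[OF norm_sum]) (simp add: norm_mult)
      also have "\<dots> \<le> M"
        unfolding M_def using b G by (intro finite_sum_le_infsum) auto
      finally have 2: "S b x \<le> M" .
      have dG: "d G \<ge> 0" unfolding d_def M_def
        using a b G by (intro add_nonneg_nonneg) (auto intro!: finite_sum_le_infsum)
      have "(S a x)\<^sup>2 \<le> (S b x + d G)\<^sup>2"
        using 1 by (intro power_mono) (auto simp: S_def)
      also have "\<dots> = (S b x)\<^sup>2 + (2 * S b x * d G + (d G)\<^sup>2)" by (simp add: power2_sum)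
      also have "\<dots> \<le> (S b x)\<^sup>2 + (2 * M * d G + (d G)\<^sup>2)"
        using 2 dG by (simp add: mult_right_mono)
      finally show ?thesis .
    qed
    have "real N ^ CARD('n) * (\<Sum>k\<in>G. (norm (a k))\<^sup>2) = (\<Sum>x\<in>index_box N. (S a x)\<^sup>2)"
      using discrete_parseval[OF N(1)] by (simp add: S_def)
    also have "\<dots> \<le> (\<Sum>x\<in>index_box N. (S b x)\<^sup>2 + (2 * M * d G + (d G)\<^sup>2))"
      by (rule sum_mono) (rule le)
    also have "\<dots> = real N ^ CARD('n) * ((\<Sum>k\<in>G. (norm (b k))\<^sup>2) + (2 * M * d G + (d G)\<^sup>2))"
      using discrete_parseval[OF N(1)]
      by (simp add: S_def sum.distrib card_box[where 'n='n] distrib_left)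
    finally have "(\<Sum>k\<in>G. (norm (a k))\<^sup>2) \<le> (\<Sum>k\<in>G. (norm (b k))\<^sup>2) + (2 * M * d G + (d G)\<^sup>2)"
      using N(2) by simp
    moreover have "(\<Sum>k\<in>F. (norm (a k))\<^sup>2) \<le> (\<Sum>k\<in>G. (norm (a k))\<^sup>2)"
      using G by (intro sum_mono2) auto
    ultimately show ?thesis by linarith
  qed
  show "\<forall>\<^sub>F G in finite_subsets_at_top UNIV.
      (\<Sum>k\<in>F. (norm (a k))\<^sup>2) \<le> (\<Sum>k\<in>G. (norm (b k))\<^sup>2) + (2 * M * d G + (d G)\<^sup>2)"
    unfolding eventually_finite_subsets_at_top using key F by blast
qed simp

subsection \<open>Slices of a rational function\<close>

definition tdeg :: "nat ^ 'n::finite \<Rightarrow> nat" where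
  "tdeg k = (\<Sum>j\<in>UNIV. k $ j)"

lemma finite_tdeg [simp, intro]: "finite {k :: nat ^ 'n::finite. tdeg k = m}"
proof (rule finite_subset)
  show "{k :: nat ^ 'n. tdeg k = m} \<subseteq> index_box (Suc m)"
    by (auto simp: index_box_def tdeg_def less_Suc_eq_le intro!: member_le_sum)
qed simp

lemma tdeg_add: "tdeg (k + l) = tdeg k + tdeg l"
  by (simp add: tdeg_def sum.distrib)

lemma monom_eval_add: "monom_eval (k + l) z = monom_eval k z * monom_eval l z"
  by (simp add: monom_eval_def power_add prod.distrib)

lemma monom_eval_scale: "monom_eval k (t *s z) = t ^ tdeg k * monom_eval k z"
  by (simp add: monom_eval_def tdeg_def power_mult_distrib prod.distrib power_sum)

lemma one_plus_tdeg_le: "1 + real (tdeg k) \<le> (\<Prod>j\<in>UNIV. 1 + real (k $ j))"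
proof -
  have "1 + (\<Sum>j\<in>A. real (k $ j)) \<le> (\<Prod>j\<in>A. 1 + real (k $ j))" if "finite A" for A
    using that
  proof induction
    case (insert x A)
    have "1 \<le> (\<Prod>j\<in>A. 1 + real (k $ j))" by (rule prod_ge_1) simp
    then have "real (k $ x) * 1 \<le> real (k $ x) * (\<Prod>j\<in>A. 1 + real (k $ j))"
      by (intro mult_left_mono) auto
    with insert show ?case by (simp add: distrib_right)
  qed simp
  from this[of UNIV] show ?thesis by (simp add: tdeg_def)
qed

lemma summable_weighted_monom:
  fixes z :: "complex ^ 'n::finite"
  assumes "z \<in> polydisc"
  shows "(\<lambda>k. (1 + real (tdeg k)) * norm (monom_eval k z)) summable_on UNIV"
proof (rule summable_on_comparison_test)
  have "(\<lambda>i. norm ((1 + real i) * norm (z $ j) ^ i)) summable_on UNIV" for j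
  proof -
    have "(\<lambda>n. of_nat (Suc n) * norm (z $ j) ^ n) sums (1 / (1 - norm (z $ j))\<^sup>2)"
      using assms by (intro geometric_deriv_sums) (simp add: polydisc_def)
    then have "summable (\<lambda>i. norm ((1 + real i) * norm (z $ j) ^ i))"
      by (auto simp: sums_iff abs_mult)
    then show ?thesis by (subst summable_on_UNIV_nonneg_real_iff) auto
  qed
  then show "(\<lambda>k::nat ^ 'n. norm (\<Prod>j\<in>UNIV. (1 + real (k $ j)) * norm (z $ j) ^ (k $ j))) summable_on UNIV"
    by (rule abs_summable_prod)
  show "(1 + real (tdeg k)) * norm (monom_eval k z) \<le>
      norm (\<Prod>j\<in>UNIV. (1 + real (k $ j)) * norm (z $ j) ^ (k $ j))" for k :: "nat ^ 'n"
  proof -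
    have "norm (\<Prod>j\<in>UNIV. (1 + real (k $ j)) * norm (z $ j) ^ (k $ j)) =
        (\<Prod>j\<in>UNIV. 1 + real (k $ j)) * norm (monom_eval k z)"
      by (simp add: monom_eval_def prod.distrib prod_norm[symmetric] norm_power abs_mult abs_prod)
    then show ?thesis using one_plus_tdeg_le[of k] by (simp add: mult_right_mono)
  qed
qed simp

lemma has_sum_by_degree:
  fixes f :: "nat ^ 'n::finite \<Rightarrow> complex"
  assumes "(\<lambda>k. norm (f k)) summable_on UNIV"
    and "(\<lambda>m. \<Sum>k\<in>{k. tdeg k = m}. f k) sums S"
  shows "(f has_sum S) UNIV"
proof -
  have "f summable_on UNIV" by (rule abs_summable_summable) fact
  then have "(f has_sum infsum f UNIV) UNIV" by simp
  also have "?this \<longleftrightarrow> ((\<lambda>(m, k). f k) has_sum infsum f UNIV) (Sigma UNIV (\<lambda>m. {k. tdeg k = m}))"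
    by (rule has_sum_reindex_bij_witness[of _ snd "\<lambda>k. (tdeg k, k)"]) auto
  finally have "((\<lambda>m. \<Sum>k\<in>{k. tdeg k = m}. f k) has_sum infsum f UNIV) UNIV"
    by (rule has_sum_SigmaD) auto
  then have "(\<lambda>m. \<Sum>k\<in>{k. tdeg k = m}. f k) sums infsum f UNIV" by (rule has_sum_imp_sums)
  then have "S = infsum f UNIV" using assms(2) sums_unique2 by blast
  with \<open>(f has_sum infsum f UNIV) UNIV\<close> show ?thesis by simp
qed

definition homogeneous :: "nat \<Rightarrow> (complex ^ 'n::finite \<Rightarrow> complex) \<Rightarrow> bool" where
  "homogeneous m h \<longleftrightarrow> (\<exists>c. \<forall>z. h z = (\<Sum>k\<in>{k. tdeg k = m}. c k * monom_eval k z))"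

lemma homogeneous_monom: "homogeneous (tdeg k) (\<lambda>z. a * monom_eval k z)"
  unfolding homogeneous_def
  by (rule exI[of _ "\<lambda>l. if l = k then a else 0"])
    (simp add: if_distrib[of "\<lambda>x. x * _"] sum.delta cong: if_cong)

lemma homogeneous_0: "homogeneous m (\<lambda>_. 0)"
  unfolding homogeneous_def by (rule exI[of _ "\<lambda>_. 0"]) simp

lemma homogeneous_add: 
  assumes "homogeneous m f" "homogeneous m g"
  shows "homogeneous m (\<lambda>z. f z + g z)"
proof -
  from assms obtain c d where "\<And>z. f z = (\<Sum>k\<in>{k. tdeg k = m}. c k * monom_eval k z)"
    "\<And>z. g z = (\<Sum>k\<in>{k. tdeg k = m}. d k * monom_eval k z)"
    unfolding homogeneous_def by blast
  then show ?thesis unfolding homogeneous_def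
    by (intro exI[of _ "\<lambda>k. c k + d k"]) (simp add: distrib_right sum.distrib)
qed

lemma homogeneous_cmult:
  assumes "homogeneous m f"
  shows "homogeneous m (\<lambda>z. a * f z)"
proof -
  from assms obtain c where "\<And>z. f z = (\<Sum>k\<in>{k. tdeg k = m}. c k * monom_eval k z)"
    unfolding homogeneous_def by blast
  then show ?thesis unfolding homogeneous_def
    by (intro exI[of _ "\<lambda>k. a * c k"]) (simp add: sum_distrib_left mult_ac)
qed

lemma homogeneous_sum:
  assumes "\<And>i. i \<in> I \<Longrightarrow> homogeneous m (f i)"
  shows "homogeneous m (\<lambda>z. \<Sum>i\<in>I. f i z)"
  using assms by (induction I rule: infinite_finite_induct) (auto intro: homogeneous_0 homogeneous_add)

lemma homogeneous_mult:
  assumes "homogeneous m f" "homogeneous n g"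
  shows "homogeneous (m + n) (\<lambda>z. f z * g z)"
proof -
  from assms obtain c d where f: "\<And>z. f z = (\<Sum>k\<in>{k. tdeg k = m}. c k * monom_eval k z)"
    and g: "\<And>z. g z = (\<Sum>k\<in>{k. tdeg k = n}. d k * monom_eval k z)"
    unfolding homogeneous_def by blast
  have "homogeneous (m + n) (\<lambda>z. \<Sum>k\<in>{k. tdeg k = m}. \<Sum>l\<in>{k. tdeg k = n}. (c k * d l) * monom_eval (k + l) z)"
    by (intro homogeneous_sum) (auto simp: tdeg_add[symmetric] intro!: homogeneous_monom)
  then show ?thesis by (simp add: f g sum_product monom_eval_add mult_ac)
qed

definition slice :: "'n::finite mpoly \<Rightarrow> complex ^ 'n \<Rightarrow> complex poly" where
  "slice p z = (\<Sum>k\<in>Poly_Mapping.keys p. monom (Poly_Mapping.lookup p k * monom_eval k z) (tdeg k))"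

lemma poly_slice: "poly (slice p z) t = eval_poly p (t *s z)"
  by (simp add: slice_def poly_sum poly_monom eval_poly_def monom_eval_scale mult_ac)

lemma homogeneous_coeff_slice: "homogeneous m (\<lambda>z. coeff (slice p z) m)"
proof -
  have "homogeneous m (\<lambda>z. \<Sum>k\<in>Poly_Mapping.keys p. if tdeg k = m then Poly_Mapping.lookup p k * monom_eval k z else 0)"
  proof (rule homogeneous_sum)
    show "homogeneous m (\<lambda>z. if tdeg k = m then Poly_Mapping.lookup p k * monom_eval k z else 0)" for k
      by (cases "tdeg k = m") (auto intro: homogeneous_monom homogeneous_0)
  qed
  then show ?thesis by (simp add: slice_def coeff_sum)
qed

lemma coeff_slice_0: "coeff (slice p z) 0 = eval_poly p 0"
  using poly_slice[of p z 0] by (simp add: poly_0_coeff_0)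

definition slice_quotient :: "'n::finite mpoly \<Rightarrow> 'n mpoly \<Rightarrow> complex ^ 'n \<Rightarrow> complex fps" where
  "slice_quotient q p z = fps_of_poly (slice q z) / fps_of_poly (slice p z)"

lemma homogeneous_slice_quotient:
  fixes p q :: "'n::finite mpoly"
  assumes "eval_poly p 0 \<noteq> 0"
  shows "homogeneous m (\<lambda>z. fps_nth (slice_quotient q p z) m)"
proof (induction m rule: less_induct)
  case (less m)
  let ?F = "slice_quotient q p"
  have rec: "fps_nth (?F z) m = inverse (eval_poly p 0) *
      (coeff (slice q z) m + (- 1) * (\<Sum>i<m. fps_nth (?F z) i * coeff (slice p z) (m - i)))" for z
  proof -
    have "fps_nth (fps_of_poly (slice p z)) 0 \<noteq> 0" using assms by (simp add: coeff_slice_0)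
    then have "?F z * fps_of_poly (slice p z) = fps_of_poly (slice q z)"
      unfolding slice_quotient_def by (subst fps_divide_unit) (auto simp: mult.assoc inverse_mult_eq_1)
    then have "coeff (slice q z) m = (\<Sum>i\<le>m. fps_nth (?F z) i * coeff (slice p z) (m - i))"
      by (metis (no_types, lifting) atLeast0AtMost fps_mult_nth fps_of_poly_nth sum.cong)
    also have "\<dots> = (\<Sum>i<m. fps_nth (?F z) i * coeff (slice p z) (m - i)) + fps_nth (?F z) m * eval_poly p 0"
      by (simp add: lessThan_Suc_atMost[symmetric] coeff_slice_0)
    finally show ?thesis using assms by (simp add: field_simps)
  qed
  have "homogeneous m (\<lambda>z. fps_nth (?F z) i * coeff (slice p z) (m - i))" if "i < m" for i
    using homogeneous_mult[OF less[OF that] homogeneous_coeff_slice, of "m - i" p] that by simp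
  then show ?case unfolding rec
    by (intro homogeneous_cmult homogeneous_add homogeneous_sum homogeneous_coeff_slice) auto
qed

lemma slice_quotient_coefficients:
  fixes p q :: "'n::finite mpoly"
  assumes "eval_poly p 0 \<noteq> 0"
  obtains c :: "nat ^ 'n \<Rightarrow> complex" where
    "\<And>m z. fps_nth (slice_quotient q p z) m = (\<Sum>k\<in>{k. tdeg k = m}. c k * monom_eval k z)"
proof -
  have "\<forall>m. \<exists>c. \<forall>z. fps_nth (slice_quotient q p z) m = (\<Sum>k\<in>{k. tdeg k = m}. c k * monom_eval k z)"
    using homogeneous_slice_quotient[OF assms, of _ q] unfolding homogeneous_def by blast
  then obtain C where C: "\<And>m z. fps_nth (slice_quotient q p z) m = (\<Sum>k\<in>{k. tdeg k = m}. C m k * monom_eval k z)"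
    by metis
  show ?thesis by (rule that[of "\<lambda>k. C (tdeg k) k"]) (simp add: C)
qed

lemma has_fps_expansion_slice_quotient:
  assumes "eval_poly p 0 \<noteq> 0"
  shows "(\<lambda>t. eval_poly q (t *s z) / eval_poly p (t *s z)) has_fps_expansion slice_quotient q p z"
  unfolding slice_quotient_def poly_slice[symmetric] using assms
  by (intro has_fps_expansion_divide') (auto simp: coeff_slice_0 has_fps_expansion_def eval_fps_of_poly)

lemma holomorphic_slice:
  assumes "\<And>t. t \<in> S \<Longrightarrow> eval_poly p (t *s z) \<noteq> 0"
  shows "(\<lambda>t. eval_poly q (t *s z) / eval_poly p (t *s z)) holomorphic_on S"
  unfolding poly_slice[symmetric] using assms 
  by (intro holomorphic_intros) (auto simp: poly_slice)

lemma slice_quotient_sums: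
  assumes "\<And>t. norm t < R \<Longrightarrow> eval_poly p (t *s z) \<noteq> 0" "norm t < R"
  shows "(\<lambda>m. fps_nth (slice_quotient q p z) m * t ^ m) sums (eval_poly q (t *s z) / eval_poly p (t *s z))"
proof (rule has_fps_expansion_imp_sums_complex)
  have "R > 0" using assms(2) norm_ge_zero[of t] by linarith
  then show "(\<lambda>t. eval_poly q (t *s z) / eval_poly p (t *s z)) has_fps_expansion slice_quotient q p z"
    using assms(1)[of 0] by (intro has_fps_expansion_slice_quotient) simp
  show "(\<lambda>t. eval_poly q (t *s z) / eval_poly p (t *s z)) holomorphic_on eball 0 (ereal R)"
    by (rule holomorphic_slice) (use assms(1) in auto)
qed (use assms in simp)

lemma scaled_in_polydisc:
  assumes "norm t < 1" "\<And>j. norm (z $ j) \<le> 1"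
  shows "t *s z \<in> polydisc"
proof -
  have "norm t * norm (z $ j) < 1" for j
    using mult_left_le[OF assms(2)[of j], of "norm t"] assms(1) by simp
  then show ?thesis by (simp add: polydisc_def norm_mult)
qed

lemma zero_in_polydisc [simp]: "0 \<in> polydisc"
  by (simp add: polydisc_def)

lemma norm_slice_quotient_le:
  assumes "\<And>z. z \<in> polydisc \<Longrightarrow> eval_poly p z \<noteq> 0"
    and "\<And>z. z \<in> polydisc \<Longrightarrow> norm (eval_poly q z) \<le> norm (eval_poly p z)"
    and w: "\<And>j. norm (w $ j) \<le> 1"
  shows "norm (fps_nth (slice_quotient q p w) m) \<le> 1"
proof -
  let ?f = "\<lambda>t. eval_poly q (t *s w) / eval_poly p (t *s w)"
  have le: "norm (fps_nth (slice_quotient q p w) m) * r ^ m \<le> 1" if r: "0 < r" "r < 1" for r :: real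
  proof -
    have "?f holomorphic_on cball 0 r"
      using r w assms(1) by (intro holomorphic_slice) (auto intro!: assms(1) scaled_in_polydisc)
    moreover have "norm (?f t) \<le> 1" if "norm (0 - t) = r" for t
      using assms(1,2)[of "t *s w"] scaled_in_polydisc[of t w] w r that by (simp add: norm_divide)
    ultimately have "norm ((deriv ^^ m) ?f 0) \<le> fact m * 1 / r ^ m"
      using r by (intro Cauchy_inequality) (auto intro: holomorphic_on_subset holomorphic_on_imp_continuous_on)
    then show ?thesis
      unfolding fps_nth_fps_expansion[OF has_fps_expansion_slice_quotient[OF assms(1)[OF zero_in_polydisc]]]
      using r by (simp add: norm_divide field_simps)
  qed
  have "((\<lambda>r. norm (fps_nth (slice_quotient q p w) m) * r ^ m) \<longlongrightarrow>
      norm (fps_nth (slice_quotient q p w) m) * 1 ^ m) (at_left (1::real))"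
    by (intro tendsto_intros)
  then have "norm (fps_nth (slice_quotient q p w) m) * 1 ^ m \<le> 1"
  proof (rule tendsto_upperbound)
    show "\<forall>\<^sub>F r in at_left (1::real). norm (fps_nth (slice_quotient q p w) m) * r ^ m \<le> 1"
      by (rule eventually_mono[OF eventually_at_left_real[of 0 "1::real"]]) (auto intro: le)
  qed simp
  then show ?thesis by simp
qed

lemma norm_coefficients_le:
  fixes c :: "nat ^ 'n::finite \<Rightarrow> complex"
  assumes "\<And>w :: complex ^ 'n. (\<And>j. norm (w $ j) = 1) \<Longrightarrow>
      norm (\<Sum>k\<in>{k. tdeg k = m}. c k * monom_eval k w) \<le> 1"
    and "tdeg k = m"
  shows "norm (c k) \<le> 1"
proof -
  let ?K = "{k :: nat ^ 'n. tdeg k = m}"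
  obtain N where N: "?K \<subseteq> index_box N" "N > 0" using finite_subset_box[OF finite_tdeg] by blast
  have "real N ^ CARD('n) * (\<Sum>k\<in>?K. (norm (c k))\<^sup>2) =
      (\<Sum>x\<in>index_box N. (norm (\<Sum>k\<in>?K. c k * monom_eval k (root_vec N x)))\<^sup>2)"
    using discrete_parseval[OF N(1)] by simp
  also have "\<dots> \<le> (\<Sum>x\<in>(index_box N :: (nat ^ 'n) set). 1)"
    by (intro sum_mono) (use assms(1) in \<open>auto simp: power_le_one\<close>)
  also have "\<dots> = real N ^ CARD('n) * 1" by (simp add: card_box)
  finally have "(\<Sum>k\<in>?K. (norm (c k))\<^sup>2) \<le> 1" using N(2) by simp
  moreover have "(norm (c k))\<^sup>2 \<le> (\<Sum>k\<in>?K. (norm (c k))\<^sup>2)"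
    using assms(2) by (intro member_le_sum) auto
  ultimately have "(norm (c k))\<^sup>2 \<le> 1" by linarith
  then show ?thesis by (simp add: power_le_one_iff)
qed

subsection \<open>The reflection and the radial derivative\<close>

lemma norm_moebius:
  fixes a l :: complex
  assumes "norm a < 1" "norm l \<le> 1"
  shows "1 + cnj a * l \<noteq> 0" "norm ((l + a) / (1 + cnj a * l)) \<le> 1"
    "norm l = 1 \<Longrightarrow> norm ((l + a) / (1 + cnj a * l)) = 1"
proof -
  have "norm (cnj a * l) < 1"
    using assms mult_left_le[of "norm l" "norm a"] by (simp add: norm_mult)
  then show nz: "1 + cnj a * l \<noteq> 0"
    by (metis add.commute add_eq_0_iff norm_minus_cancel norm_one order_less_irrefl)
  have id: "(norm (1 + cnj a * l))\<^sup>2 - (norm (l + a))\<^sup>2 = (1 - (norm a)\<^sup>2) * (1 - (norm l)\<^sup>2)"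
    by (simp add: cmod_power2) (simp add: power2_eq_square algebra_simps)
  moreover have "(norm a)\<^sup>2 \<le> 1" "(norm l)\<^sup>2 \<le> 1" using assms by (auto simp: power_le_one)
  ultimately have "(norm (l + a))\<^sup>2 \<le> (norm (1 + cnj a * l))\<^sup>2"
    by (smt (verit) mult_nonneg_nonneg)
  then have "norm (l + a) \<le> norm (1 + cnj a * l)" by (rule power2_le_imp_le) simp
  then show "norm ((l + a) / (1 + cnj a * l)) \<le> 1"
    using nz by (simp add: norm_divide)
  assume "norm l = 1"
  then have "norm (1 + cnj a * l) = norm (l + a)"
    using id by simp
  moreover have "norm (1 + cnj a * l) \<noteq> 0" using nz by simp
  ultimately show "norm ((l + a) / (1 + cnj a * l)) = 1"
    by (metis norm_divide divide_self)
qed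

lemma norm_scaled_reflection_torus:
  fixes p :: "'n::finite mpoly"
  assumes "\<And>j. norm (w $ j) = 1"
  shows "norm (\<Sum>k\<in>Poly_Mapping.keys p. cnj (Poly_Mapping.lookup p k) * of_real r ^ tdeg k * monom_eval (multidegree p - k) w) =
    norm (eval_poly p (of_real r *s w))"
proof -
  have 1: "w $ j * cnj (w $ j) = 1" for j
    using complex_norm_square[of "w $ j"] assms[of j] by simp
  have "monom_eval (multidegree p - k) w = monom_eval (multidegree p) w * cnj (monom_eval k w)"
    if "k \<in> Poly_Mapping.keys p" for k
  proof -
    have "w $ j ^ (multidegree p $ j - k $ j) = w $ j ^ (multidegree p $ j) * cnj (w $ j) ^ (k $ j)" for j
    proof -
      have "w $ j ^ (multidegree p $ j) * cnj (w $ j) ^ (k $ j) =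
          w $ j ^ (multidegree p $ j - k $ j) * (w $ j * cnj (w $ j)) ^ (k $ j)"
        using le_multidegree[OF that, of j]
        by (simp add: power_mult_distrib mult.assoc[symmetric] power_add[symmetric])
      then show ?thesis by (simp add: 1)
    qed
    then show ?thesis by (simp add: monom_eval_def prod.distrib)
  qed
  then have "(\<Sum>k\<in>Poly_Mapping.keys p. cnj (Poly_Mapping.lookup p k) * of_real r ^ tdeg k * monom_eval (multidegree p - k) w) =
      monom_eval (multidegree p) w * cnj (eval_poly p (of_real r *s w))"
    by (simp add: eval_poly_def monom_eval_scale sum_distrib_left mult_ac)
  then show ?thesis
    using norm_monom_eval_torus[of w "multidegree p"] assms by (simp add: norm_mult)
qed

text \<open>
  For \<open>r < 1\<close> the maximum principle is applied to the disc \<open>l \<mapsto> ((l + z\<^sub>j) / (1 + cnj z\<^sub>j l))\<^sub>j\<close>,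
  whose centre is \<open>z\<close> and whose boundary lies on the torus, where \<open>p (r \<cdot>)\<close> and its reflection
  have the same modulus.
\<close>

lemma norm_reflection_le:
  fixes p :: "'n::finite mpoly"
  assumes nz: "\<And>z. z \<in> polydisc \<Longrightarrow> eval_poly p z \<noteq> 0" and z: "z \<in> polydisc"
  shows "norm (eval_poly (reflection p) z) \<le> norm (eval_poly p z)"
proof -
  define Q where "Q r w = (\<Sum>k\<in>Poly_Mapping.keys p. cnj (Poly_Mapping.lookup p k) * of_real r ^ tdeg k * monom_eval (multidegree p - k) w)"
    for r :: real and w
  have le: "norm (Q r z) \<le> norm (eval_poly p (of_real r *s z))" if r: "0 < r" "r < 1" for r
  proof -
    define \<mu> where "\<mu> l = (\<chi> j. (l + z $ j) / (1 + cnj (z $ j) * l))" for l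
    define f where "f l = Q r (\<mu> l) / eval_poly p (of_real r *s \<mu> l)" for l
    have zj: "norm (z $ j) < 1" for j using z by (simp add: polydisc_def)
    have nz': "eval_poly p (of_real r *s \<mu> l) \<noteq> 0" if "norm l \<le> 1" for l
      using r norm_moebius(2)[OF zj that] by (intro nz scaled_in_polydisc) (auto simp: \<mu>_def)
    have mon: "(\<lambda>l. monom_eval k (\<mu> l)) holomorphic_on cball 0 1" for k
      unfolding monom_eval_def \<mu>_def vec_lambda_beta
      using norm_moebius(1)[OF zj] by (intro holomorphic_intros) auto
    have hol: "f holomorphic_on cball 0 1"
      unfolding f_def Q_def eval_poly_def monom_eval_scale
      using nz' by (intro holomorphic_intros mon) (auto simp: eval_poly_def monom_eval_scale)
    have "norm (f 0) \<le> 1"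
    proof (rule maximum_modulus_frontier[of f "cball 0 1"])
      show "f holomorphic_on interior (cball 0 1)"
        using hol by (rule holomorphic_on_subset) simp
      show "continuous_on (closure (cball 0 1)) f"
        using hol by (simp add: holomorphic_on_imp_continuous_on)
      fix l :: complex assume "l \<in> frontier (cball 0 1)"
      then have l: "norm l = 1" by simp
      have "norm (Q r (\<mu> l)) = norm (eval_poly p (of_real r *s \<mu> l))"
        unfolding Q_def using norm_moebius(3)[OF zj _ l] l
        by (intro norm_scaled_reflection_torus) (auto simp: \<mu>_def)
      then show "norm (f l) \<le> 1" by (simp add: f_def norm_divide)
    qed auto
    moreover have "\<mu> 0 = z" by (simp add: \<mu>_def vec_eq_iff)
    ultimately show ?thesis
      using nz'[of 0] by (simp add: f_def norm_divide)
  qed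
  have "Q 1 z = eval_poly (reflection p) z"
    by (simp add: Q_def reflection_def eval_poly_sum eval_poly_single)
  moreover have "((\<lambda>r. norm (Q r z)) \<longlongrightarrow> norm (Q 1 z)) (at_left 1)"
    unfolding Q_def by (intro tendsto_intros)
  moreover have "((\<lambda>r. norm (eval_poly p (of_real r *s z))) \<longlongrightarrow> norm (eval_poly p (of_real 1 *s z))) (at_left 1)"
    unfolding poly_slice[symmetric] by (intro tendsto_intros)
  ultimately show ?thesis
    using eventually_mono[OF eventually_at_left_real[of 0 "1::real"], of "\<lambda>r. norm (Q r z) \<le> norm (eval_poly p (of_real r *s z))"] le
    by (auto intro!: tendsto_le[of "at_left (1::real)"])
qed

definition radial :: "'n::finite mpoly \<Rightarrow> complex ^ 'n \<Rightarrow> complex" where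
  "radial p z = (\<Sum>k\<in>Poly_Mapping.keys p. of_nat (tdeg k) * Poly_Mapping.lookup p k * monom_eval k z)"

lemma DERIV_radial: "((\<lambda>t. eval_poly p (t *s z)) has_field_derivative radial p z) (at 1)"
  unfolding eval_poly_def radial_def monom_eval_scale
  by (auto intro!: derivative_eq_intros sum.cong simp: sum_distrib_left)

lemma norm_monom_eval_le_1:
  assumes "z \<in> polydisc"
  shows "norm (monom_eval k (z :: complex ^ 'n::finite)) \<le> 1"
  unfolding monom_eval_def prod_norm[symmetric] norm_power
  using assms by (intro prod_le_1 conjI power_le_one) (auto simp: polydisc_def less_imp_le)

lemma radial_bounded:
  fixes p :: "'n::finite mpoly"
  obtains B where "B \<ge> 0" "\<And>z. z \<in> polydisc \<Longrightarrow> norm (radial p z) \<le> B"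
proof
  let ?B = "\<Sum>k\<in>Poly_Mapping.keys p. real (tdeg k) * norm (Poly_Mapping.lookup p k)"
  show "?B \<ge> 0" by (intro sum_nonneg) auto
  fix z :: "complex ^ 'n" assume z: "z \<in> polydisc"
  show "norm (radial p z) \<le> ?B"
    unfolding radial_def
    by (intro sum_norm_le) (auto simp: norm_mult intro!: mult_left_le norm_monom_eval_le_1[OF z])
qed

lemma eval_poly_bounded:
  fixes p :: "'n::finite mpoly"
  obtains B where "B \<ge> 0" "\<And>z. z \<in> polydisc \<Longrightarrow> norm (eval_poly p z) \<le> B"
proof
  let ?B = "\<Sum>k\<in>Poly_Mapping.keys p. norm (Poly_Mapping.lookup p k)"
  show "?B \<ge> 0" by (intro sum_nonneg) auto
  fix z :: "complex ^ 'n" assume z: "z \<in> polydisc"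
  show "norm (eval_poly p z) \<le> ?B"
    unfolding eval_poly_def
    by (intro sum_norm_le) (auto simp: norm_mult intro!: mult_left_le norm_monom_eval_le_1[OF z])
qed

lemma polydisc_scale_radius:
  fixes z :: "complex ^ 'n::finite"
  assumes "z \<in> polydisc"
  obtains R where "R > 1" "\<And>t. norm t < R \<Longrightarrow> t *s z \<in> polydisc"
proof -
  define m where "m = Max (insert (1/2) (range (\<lambda>j. norm (z $ j))))"
  have m: "0 < m" "m < 1"
    using assms by (auto simp: m_def polydisc_def less_max_iff_disj)
  have m3: "norm (z $ j) \<le> m" for j
    unfolding m_def by (rule Max_ge) auto
  show ?thesis
  proof (rule that[of "1 / m"])
    fix t :: complex assume "norm t < 1 / m"
    then have "norm t * m < 1" using m(1) by (simp add: field_simps)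
    moreover have "norm t * norm (z $ j) \<le> norm t * m" for j
      by (rule mult_left_mono) (use m3 in auto)
    ultimately show "t *s z \<in> polydisc"
      by (auto simp: polydisc_def norm_mult intro: le_less_trans)
  qed (use m in auto)
qed

lemma quotient_power_series:
  fixes p q :: "'n::finite mpoly"
  assumes nz: "\<And>z. z \<in> polydisc \<Longrightarrow> eval_poly p z \<noteq> 0"
    and le: "\<And>z. z \<in> polydisc \<Longrightarrow> norm (eval_poly q z) \<le> norm (eval_poly p z)"
  obtains c :: "nat ^ 'n \<Rightarrow> complex" and g K where
    "\<And>z. z \<in> polydisc \<Longrightarrow> ((\<lambda>k. c k * monom_eval k z) has_sum (eval_poly q z / eval_poly p z)) UNIV"
    "\<And>z. z \<in> polydisc \<Longrightarrow> ((\<lambda>k. (1 + of_nat (tdeg k)) * c k * monom_eval k z) has_sum g z) UNIV"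
    "\<And>z. z \<in> polydisc \<Longrightarrow> norm (g z) \<le> K / norm (eval_poly p z)"
proof -
  obtain c :: "nat ^ 'n \<Rightarrow> complex" where
    c: "\<And>m z. fps_nth (slice_quotient q p z) m = (\<Sum>k\<in>{k. tdeg k = m}. c k * monom_eval k z)"
    using slice_quotient_coefficients[of p q] nz[OF zero_in_polydisc] by blast
  have c_le: "norm (c k) \<le> 1" for k
    by (rule norm_coefficients_le[where m = "tdeg k"]) (use norm_slice_quotient_le[OF nz le] in \<open>auto simp: c[symmetric]\<close>)
  have abs: "(\<lambda>k. norm ((1 + of_nat (tdeg k)) * c k * monom_eval k z)) summable_on UNIV"
    "(\<lambda>k. norm (c k * monom_eval k z)) summable_on UNIV" if "z \<in> polydisc" for z
  proof -
    have "norm (1 + of_nat n :: complex) = 1 + real n" for n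
      by (metis norm_of_nat of_nat_Suc)
    then show "(\<lambda>k. norm ((1 + of_nat (tdeg k)) * c k * monom_eval k z)) summable_on UNIV"
      by (intro summable_on_comparison_test[OF summable_weighted_monom[OF that]])
        (auto simp: norm_mult mult.assoc intro!: mult_left_mono mult_left_le_one_le c_le)
    have "norm (c k * monom_eval k z) \<le> (1 + real (tdeg k)) * norm (monom_eval k z)" for k
      by (simp add: norm_mult) (intro mult_right_mono order_trans[OF c_le], auto)
    then show "(\<lambda>k. norm (c k * monom_eval k z)) summable_on UNIV"
      by (intro summable_on_comparison_test[OF summable_weighted_monom[OF that]]) auto
  qed
  define g where "g z = eval_poly q z / eval_poly p z +
     (radial q z * eval_poly p z - eval_poly q z * radial p z) / (eval_poly p z * eval_poly p z)" for z
  have s1: "(\<lambda>m. fps_nth (slice_quotient q p z) m) sums (eval_poly q z / eval_poly p z)"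
    and s2: "(\<lambda>m. (1 + of_nat m) * fps_nth (slice_quotient q p z) m) sums g z" if z: "z \<in> polydisc" for z
  proof -
    let ?F = "fps_nth (slice_quotient q p z)"
    obtain R where R: "R > 1" "\<And>t. norm t < R \<Longrightarrow> t *s z \<in> polydisc"
      using polydisc_scale_radius[OF z] by blast
    have sums: "(\<lambda>m. ?F m * t ^ m) sums (eval_poly q (t *s z) / eval_poly p (t *s z))" if "norm t < R" for t
      by (rule slice_quotient_sums[OF _ that]) (rule nz[OF R(2)])
    show 1: "?F sums (eval_poly q z / eval_poly p z)"
      using sums[of 1] R(1) by simp
    have "((\<lambda>t. suminf (\<lambda>n. ?F n * t ^ n)) has_field_derivative (suminf (\<lambda>n. diffs ?F n * 1 ^ n))) (at 1)"
      using sums R(1) by (intro termdiffs_strong'[of R]) (auto simp: sums_iff)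
    moreover have "((\<lambda>t. eval_poly q (t *s z) / eval_poly p (t *s z)) has_field_derivative
        (radial q z * eval_poly p (1 *s z) - eval_poly q (1 *s z) * radial p z) / (eval_poly p (1 *s z) * eval_poly p (1 *s z))) (at 1)"
      using nz[OF z] by (intro DERIV_divide DERIV_radial) simp
    then have "((\<lambda>t. suminf (\<lambda>n. ?F n * t ^ n)) has_field_derivative
        (radial q z * eval_poly p (1 *s z) - eval_poly q (1 *s z) * radial p z) / (eval_poly p (1 *s z) * eval_poly p (1 *s z))) (at 1)"
      by (rule has_field_derivative_transform_within_open[of _ _ _ "ball 0 R"])
        (use sums R(1) in \<open>auto simp: sums_iff\<close>)
    ultimately have D: "suminf (diffs ?F) = g z - eval_poly q z / eval_poly p z"
      using DERIV_unique by (auto simp: g_def)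
    have "summable (\<lambda>n. diffs ?F n * 1 ^ n)"
      using sums R(1) by (intro termdiff_converges[of _ R]) (auto simp: sums_iff)
    with D have "(\<lambda>n. diffs ?F n) sums (g z - eval_poly q z / eval_poly p z)"
      by (simp add: sums_iff)
    then have "(\<lambda>m. of_nat m * ?F m) sums (g z - eval_poly q z / eval_poly p z)"
      using sums_Suc_iff[of "\<lambda>m. of_nat m * ?F m"] by (simp add: diffs_def)
    from sums_add[OF 1 this] show "(\<lambda>m. (1 + of_nat m) * ?F m) sums g z"
      by (simp add: distrib_right)
  qed
  obtain B1 where B1: "\<And>z. z \<in> polydisc \<Longrightarrow> norm (radial p z) \<le> B1" using radial_bounded[of p] by metis
  obtain B2 where B2: "\<And>z. z \<in> polydisc \<Longrightarrow> norm (radial q z) \<le> B2" using radial_bounded[of q] by metis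
  obtain B3 where B3: "\<And>z. z \<in> polydisc \<Longrightarrow> norm (eval_poly p z) \<le> B3" using eval_poly_bounded[of p] by metis
  show ?thesis
  proof (rule that[of c g "B3 + B2 + B1"])
    fix z :: "complex ^ 'n" assume z: "z \<in> polydisc"
    show "((\<lambda>k. c k * monom_eval k z) has_sum (eval_poly q z / eval_poly p z)) UNIV"
      using s1[OF z] abs(2)[OF z] by (intro has_sum_by_degree) (auto simp: c)
    have "(\<lambda>m. \<Sum>k\<in>{k. tdeg k = m}. (1 + of_nat (tdeg k)) * c k * monom_eval k z) sums g z"
      using s2[OF z] by (simp add: c sum_distrib_left mult.assoc)
    then show "((\<lambda>k. (1 + of_nat (tdeg k)) * c k * monom_eval k z) has_sum g z) UNIV"
      using abs(1)[OF z] by (intro has_sum_by_degree)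
    let ?p = "eval_poly p z" and ?q = "eval_poly q z"
    have q1: "norm (?q / ?p) \<le> 1" using nz[OF z] le[OF z] by (simp add: norm_divide)
    have "g z * ?p = ?q / ?p * ?p + radial q z - ?q / ?p * radial p z"
      using nz[OF z] by (simp add: g_def field_simps)
    also have "norm \<dots> \<le> norm (?q / ?p * ?p) + norm (radial q z) + norm (?q / ?p * radial p z)"
      by (rule order_trans[OF norm_triangle_ineq4 add_right_mono[OF norm_triangle_ineq]])
    also have "\<dots> \<le> B3 + B2 + B1"
      unfolding norm_mult
      by (intro add_mono B2[OF z] order_trans[OF mult_left_le_one_le B3[OF z]]
        order_trans[OF mult_left_le_one_le B1[OF z]] q1) auto
    finally show "norm (g z) \<le> (B3 + B2 + B1) / norm ?p"
      using nz[OF z] by (simp add: norm_mult field_simps)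
  qed
qed

subsection \<open>Binomial series and dyadic blocks\<close>

lemma binomial_coeff_square_bound:
  fixes s :: real
  assumes "s > 1"
  obtains K where "K > 0"
    "\<And>n. ((- s / 2) gchoose n)\<^sup>2 \<le> K * ((-1) ^ n * ((1 - s) gchoose n))"
proof -
  define A where "A n = ((- s / 2) gchoose n) / ((- 1) ^ n / exp ((- s / 2 + 1) * ln (real n)))" for n
  define B where "B n = ((1 - s) gchoose n) / ((- 1) ^ n / exp ((1 - s + 1) * ln (real n)))" for n
  have pos: "(-1) ^ n * ((1 - s) gchoose n) > 0" for n
    using assms by (simp add: gbinomial_pochhammer pochhammer_pos)
  have "A \<longlonglongrightarrow> inverse (Gamma (s / 2))" "B \<longlonglongrightarrow> inverse (Gamma (s - 1))"
    using gbinomial_asymptotic[of "- s / 2"] gbinomial_asymptotic[of "1 - s"]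
    by (simp_all add: A_def[abs_def] B_def[abs_def])
  moreover have "Gamma (s - 1) > 0" using assms by (intro Gamma_real_pos) simp
  ultimately have "(\<lambda>n. (A n)\<^sup>2 / B n) \<longlonglongrightarrow> (inverse (Gamma (s / 2)))\<^sup>2 / inverse (Gamma (s - 1))"
    by (intro tendsto_intros) auto
  then have "Bseq (\<lambda>n. (A n)\<^sup>2 / B n)" by (intro convergent_imp_Bseq convergentI)
  then obtain K where K: "K > 0" "\<And>n. norm ((A n)\<^sup>2 / B n) \<le> K" by (auto simp: Bseq_def)
  have eq: "(A n)\<^sup>2 / B n = ((- s / 2) gchoose n)\<^sup>2 / ((-1) ^ n * ((1 - s) gchoose n))" for n
  proof -
    have "(exp ((- s / 2 + 1) * ln (real n)))\<^sup>2 = exp ((1 - s + 1) * ln (real n))"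
      by (simp add: exp_double[symmetric] algebra_simps)
    moreover have "((- 1) ^ n)\<^sup>2 = (1::real)" by (simp add: power_mult[symmetric] mult.commute)
    ultimately show ?thesis
      by (cases "even n") (simp_all add: A_def B_def power_divide power_mult_distrib field_simps power2_eq_square)
  qed
  have "((- s / 2) gchoose n)\<^sup>2 \<le> K * ((-1) ^ n * ((1 - s) gchoose n))" for n
    using K(2)[of n] pos[of n] unfolding eq by (simp add: field_simps abs_of_pos)
  with K(1) show ?thesis by (rule that)
qed

lemma binomial_kernel:
  fixes s :: real
  assumes "s > 1"
  obtains b :: "nat \<Rightarrow> complex" and K where "K > 0"
    "\<And>z. norm z < 1 \<Longrightarrow> (\<lambda>i. norm (b i * z ^ i)) summable_on UNIV"
    "\<And>z. norm z < 1 \<Longrightarrow> norm (infsum (\<lambda>i. b i * z ^ i) UNIV) = norm (1 - z) powr (- s / 2)"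
    "\<And>r. 0 \<le> r \<Longrightarrow> r < 1 \<Longrightarrow> (\<lambda>i. (norm (b i))\<^sup>2 * r ^ (2 * i)) summable_on UNIV \<and>
       infsum (\<lambda>i. (norm (b i))\<^sup>2 * r ^ (2 * i)) UNIV \<le> K * (1 - r) powr (1 - s)"
proof -
  obtain K where K: "K > 0"
    "\<And>n. ((- s / 2) gchoose n)\<^sup>2 \<le> K * ((-1) ^ n * ((1 - s) gchoose n))"
    using binomial_coeff_square_bound[OF assms] by blast
  define b where "b i = (of_real (- s / 2) gchoose i) * (-1 :: complex) ^ i" for i
  have of_real_gbinomial: "(complex_of_real a gchoose n) = of_real (a gchoose n)" for a n
    by (simp add: gbinomial_prod_rev)
  have nb: "(norm (b i))\<^sup>2 = ((- s / 2) gchoose i)\<^sup>2" for i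
    unfolding b_def of_real_gbinomial by (simp add: norm_mult norm_power)
  have sums: "(\<lambda>i. b i * z ^ i) sums (1 - z) powr (of_real (- s / 2))" if "norm z < 1" for z
    using gen_binomial_complex[of "- z" "of_real (- s / 2)"] that
    by (simp add: b_def power_minus[of z] mult.assoc)
  have abs: "(\<lambda>i. norm (b i * z ^ i)) summable_on UNIV" if z: "norm z < 1" for z
  proof -
    obtain t where t: "norm z < t" "t < 1" using dense[OF z] by blast
    then have "t > 0" using norm_ge_zero[of z] by linarith
    then have "summable (\<lambda>i. b i * of_real t ^ i)" using sums[of "of_real t"] t by (auto simp: sums_iff)
    then have "summable (\<lambda>i. norm (b i * z ^ i))"
      by (rule powser_insidea) (use t \<open>t > 0\<close> in auto)
    then show ?thesis by (subst summable_on_UNIV_nonneg_real_iff) auto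
  qed
  show ?thesis
  proof (rule that[of K b])
    fix z :: complex assume z: "norm z < 1"
    have "(\<lambda>i. b i * z ^ i) summable_on UNIV" by (rule abs_summable_summable[OF abs[OF z]])
    then have "(\<lambda>i. b i * z ^ i) sums infsum (\<lambda>i. b i * z ^ i) UNIV" by (intro has_sum_imp_sums) simp
    then have "infsum (\<lambda>i. b i * z ^ i) UNIV = (1 - z) powr (of_real (- s / 2))"
      using sums[OF z] sums_unique2 by blast
    then show "norm (infsum (\<lambda>i. b i * z ^ i) UNIV) = norm (1 - z) powr (- s / 2)"
      by (simp add: norm_powr_real_powr')
  next
    fix r :: real assume r: "0 \<le> r" "r < 1"
    have "r\<^sup>2 \<le> r" using r by (simp add: power2_eq_square mult_left_le)
    then have r2: "r\<^sup>2 < 1" using r by linarith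
    let ?B = "\<lambda>n. K * ((-1) ^ n * ((1 - s) gchoose n)) * r ^ (2 * n)"
    have "(\<lambda>n. ((1 - s) gchoose n) * (- (r\<^sup>2)) ^ n) sums (1 + - (r\<^sup>2)) powr (1 - s)"
      using r2 by (intro gen_binomial_real) simp
    moreover have "(- (r\<^sup>2)) ^ n = (-1) ^ n * r ^ (2 * n)" for n
      by (simp add: power_mult power_minus[of "r\<^sup>2"])
    ultimately have B: "?B sums (K * (1 - r\<^sup>2) powr (1 - s))"
      using sums_mult[of "\<lambda>n. ((1 - s) gchoose n) * (- (r\<^sup>2)) ^ n" "(1 - r\<^sup>2) powr (1 - s)" K] by (simp add: mult_ac)
    have le: "(norm (b i))\<^sup>2 * r ^ (2 * i) \<le> ?B i" for i
      unfolding nb by (intro mult_right_mono K) (use r in auto)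
    have summ: "summable (\<lambda>i. (norm (b i))\<^sup>2 * r ^ (2 * i))"
      by (rule summable_comparison_test'[of ?B 0]) (use B le r in \<open>auto simp: sums_iff abs_mult\<close>)
    then have son: "(\<lambda>i. (norm (b i))\<^sup>2 * r ^ (2 * i)) summable_on UNIV"
      using r by (subst summable_on_UNIV_nonneg_real_iff) auto
    then have "infsum (\<lambda>i. (norm (b i))\<^sup>2 * r ^ (2 * i)) UNIV = suminf (\<lambda>i. (norm (b i))\<^sup>2 * r ^ (2 * i))"
      by (intro sums_unique has_sum_imp_sums) simp
    also have "\<dots> \<le> K * (1 - r\<^sup>2) powr (1 - s)"
      using suminf_le[OF le summ] B by (simp add: sums_iff)
    also have "\<dots> \<le> K * (1 - r) powr (1 - s)"
      using \<open>r\<^sup>2 \<le> r\<close> r assms K(1) by (intro mult_left_mono powr_mono2') auto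
    finally show "(\<lambda>i. (norm (b i))\<^sup>2 * r ^ (2 * i)) summable_on UNIV \<and>
       infsum (\<lambda>i. (norm (b i))\<^sup>2 * r ^ (2 * i)) UNIV \<le> K * (1 - r) powr (1 - s)"
      using son by blast
  qed (use K(1) abs in auto)
qed

lemma dyadic_power_lower_bound:
  fixes k m :: nat
  assumes "1 + k < 2 ^ (m + 1)"
  shows "1 / 16 \<le> (1 - 1 / 2 ^ (m + 1) :: real) ^ (2 * k)"
proof -
  define r :: real where "r = 1 - 1 / 2 ^ (m + 1)"
  have le1: "1 / 2 ^ (m + 1) \<le> (1 :: real)" by (subst divide_le_eq_1_pos) (auto intro: one_le_power simp del: power_Suc power_add)
  have r: "0 \<le> r" "r \<le> 1" using le1 by (auto simp: r_def)
  have "1 + real (2 ^ m) * (- (1 / 2 ^ (m + 1))) \<le> (1 + (- (1 / 2 ^ (m + 1)))) ^ (2 ^ m)"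
    by (rule Bernoulli_inequality) (use le1 in simp)
  then have "1 / 2 \<le> r ^ (2 ^ m)" by (simp add: r_def)
  then have "(1 / 2) ^ 4 \<le> (r ^ (2 ^ m)) ^ 4" by (intro power_mono) auto
  also have "\<dots> = r ^ (2 ^ m * 4)" by (simp add: power_mult)
  also have "\<dots> \<le> r ^ (2 * k)" using assms r by (intro power_decreasing) auto
  finally show ?thesis by (simp add: r_def power_divide)
qed

text \<open>
  Decompose the multi-indices into blocks \<open>2\<^bsup>m\<^sub>j\<^esup> \<le> 1 + k\<^sub>j < 2\<^bsup>m\<^sub>j + 1\<^esup>\<close> and use the hypothesis on each
  block with \<open>r\<^sub>j = 1 - 2\<^bsup>-m\<^sub>j - 1\<^esup>\<close>.
\<close>

lemma summable_dyadic:
  fixes A :: "nat ^ 'n::finite \<Rightarrow> real" and \<alpha> s K :: real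
  assumes A: "\<And>k. A k \<ge> 0" and K: "K \<ge> 0" and \<alpha>: "\<alpha> < 0" "\<alpha> + s - 1 < 0"
    and bound: "\<And>F r. finite F \<Longrightarrow> (\<And>j. 0 \<le> r $ j \<and> r $ j < 1) \<Longrightarrow>
      (\<Sum>k\<in>F. A k * (\<Prod>j\<in>UNIV. (r $ j :: real) ^ (2 * k $ j))) \<le> K * (\<Prod>j\<in>UNIV. (1 - r $ j) powr (1 - s))"
  shows "(\<lambda>k. (\<Prod>j\<in>UNIV. (1 + real (k $ j)) powr \<alpha>) * A k) summable_on UNIV"
proof (rule nonneg_bdd_above_summable_on)
  have "\<forall>n. \<exists>e. 2 ^ e \<le> 1 + n \<and> 1 + n < (2::nat) ^ (e + 1)"
    using ex_power_ivl1[of 2] by auto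
  then obtain e where e: "\<And>n. 2 ^ e n \<le> 1 + n" "\<And>n. 1 + n < (2::nat) ^ (e n + 1)" by metis
  define E where "E k = (\<chi> j. e (k $ j))" for k :: "nat ^ 'n"
  define \<rho> where "\<rho> = 2 powr (\<alpha> + s - 1)"
  have \<rho>: "0 < \<rho>" "\<rho> < 1" using \<alpha> powr_less_mono[of "\<alpha> + s - 1" 0 2] by (auto simp: \<rho>_def)
  define G where "G m = (\<Prod>j\<in>UNIV. 2 powr (s - 1) * \<rho> ^ (m $ j))" for m :: "nat ^ 'n"
  have "summable (\<lambda>i. norm (2 powr (s - 1) * \<rho> ^ i))"
    using \<rho> by (simp add: abs_mult summable_geometric summable_mult)
  then have "(\<lambda>i. norm (2 powr (s - 1) * \<rho> ^ i)) summable_on UNIV"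
    by (subst summable_on_UNIV_nonneg_real_iff) auto
  then have "(\<lambda>m. norm (G m)) summable_on UNIV"
    unfolding G_def by (rule abs_summable_prod)
  moreover have Gpos: "G m \<ge> 0" for m unfolding G_def using \<rho> by (intro prod_nonneg) auto
  ultimately have G: "G summable_on UNIV" by simp
  define M where "M = 16 ^ CARD('n) * K"
  have le1: "1 / 2 ^ (n + 1) \<le> (1 :: real)" for n :: nat
    by (subst divide_le_eq_1_pos) (auto intro: one_le_power simp del: power_Suc power_add)
  have block: "(\<Sum>k | k \<in> F \<and> E k = m. (\<Prod>j\<in>UNIV. (1 + real (k $ j)) powr \<alpha>) * A k) \<le> M * G m"
    if "finite F" for F m
  proof -
    define r :: "real ^ 'n" where "r = (\<chi> j. 1 - 1 / 2 ^ (m $ j + 1))"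
    have factor: "(2 powr \<alpha>) ^ (m $ j) * (1 - r $ j) powr (1 - s) = 2 powr (s - 1) * \<rho> ^ (m $ j)" for j
    proof -
      have "2 powr (- (real (m $ j) + 1)) = inverse (2 powr real (m $ j + 1))"
        by (simp only: powr_minus[symmetric] of_nat_add of_nat_1)
      also have "2 powr real (m $ j + 1) = 2 ^ (m $ j + 1)" by (rule powr_realpow) simp
      finally have 1: "1 - r $ j = 2 powr (- (real (m $ j) + 1))"
        by (simp add: r_def inverse_eq_divide)
      have "(2 powr \<alpha>) ^ (m $ j) * (1 - r $ j) powr (1 - s) =
          2 powr (\<alpha> * real (m $ j) + - (real (m $ j) + 1) * (1 - s))"
        unfolding 1 powr_powr powr_add by (simp add: powr_realpow[symmetric] powr_powr)
      also have "\<dots> = 2 powr ((s - 1) + (\<alpha> + s - 1) * real (m $ j))"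
        by (simp add: algebra_simps)
      also have "\<dots> = 2 powr (s - 1) * \<rho> ^ (m $ j)"
        by (simp add: \<rho>_def powr_realpow[symmetric] powr_powr powr_add)
      finally show ?thesis .
    qed
    define W where "W = (\<Prod>j\<in>UNIV. (2 powr \<alpha>) ^ (m $ j))"
    have W: "W \<ge> 0" unfolding W_def by (intro prod_nonneg) auto
    have "(\<Prod>j\<in>UNIV. (1 + real (k $ j)) powr \<alpha>) * A k \<le>
        W * (16 ^ CARD('n) * (A k * (\<Prod>j\<in>UNIV. (r $ j) ^ (2 * k $ j))))" if Ek: "E k = m" for k
    proof -
      have m: "m $ j = e (k $ j)" for j using Ek by (auto simp: E_def)
      have "(1 + real (k $ j)) powr \<alpha> \<le> (2 powr \<alpha>) ^ (m $ j)" for j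
      proof -
        have "real (2 ^ (m $ j)) \<le> real (1 + k $ j)" unfolding m of_nat_le_iff by (rule e)
        then have "(1 + real (k $ j)) powr \<alpha> \<le> (2 ^ (m $ j)) powr \<alpha>"
          using \<alpha> by (intro powr_mono2') auto
        also have "\<dots> = (2 powr \<alpha>) ^ (m $ j)"
          by (simp add: powr_realpow[symmetric] powr_powr mult.commute)
        finally show ?thesis .
      qed
      then have 1: "(\<Prod>j\<in>UNIV. (1 + real (k $ j)) powr \<alpha>) \<le> W"
        unfolding W_def by (intro prod_mono) auto
      have "(\<Prod>j\<in>(UNIV :: 'n set). 1 / 16) \<le> (\<Prod>j\<in>UNIV. (r $ j) ^ (2 * k $ j))"
      proof (rule prod_mono)
        show "0 \<le> (1 / 16 :: real) \<and> 1 / 16 \<le> (r $ j) ^ (2 * k $ j)" for j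
          using dyadic_power_lower_bound[OF e(2)[of "k $ j"]] by (simp add: r_def m)
      qed
      then have "1 \<le> 16 ^ CARD('n) * (\<Prod>j\<in>UNIV. (r $ j) ^ (2 * k $ j))"
        by (simp add: field_simps power_divide)
      from mult_left_mono[OF this A[of k]]
      have "A k \<le> 16 ^ CARD('n) * (A k * (\<Prod>j\<in>UNIV. (r $ j) ^ (2 * k $ j)))" by (simp add: mult_ac)
      with 1 show ?thesis using W A[of k] by (intro mult_mono) auto
    qed
    then have "(\<Sum>k | k \<in> F \<and> E k = m. (\<Prod>j\<in>UNIV. (1 + real (k $ j)) powr \<alpha>) * A k) \<le>
        (\<Sum>k | k \<in> F \<and> E k = m. W * (16 ^ CARD('n) * (A k * (\<Prod>j\<in>UNIV. (r $ j) ^ (2 * k $ j)))))"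
      by (intro sum_mono) auto
    also have "\<dots> = W * 16 ^ CARD('n) * (\<Sum>k | k \<in> F \<and> E k = m. A k * (\<Prod>j\<in>UNIV. (r $ j) ^ (2 * k $ j)))"
      by (simp add: sum_distrib_left mult.assoc)
    also have "\<dots> \<le> W * 16 ^ CARD('n) * (K * (\<Prod>j\<in>UNIV. (1 - r $ j) powr (1 - s)))"
      using that W le1 by (intro mult_left_mono bound) (auto simp: r_def)
    also have "\<dots> = M * (\<Prod>j\<in>UNIV. (2 powr \<alpha>) ^ (m $ j) * (1 - r $ j) powr (1 - s))"
      by (simp add: M_def W_def prod.distrib)
    also have "\<dots> = M * G m" by (simp add: factor G_def)
    finally show ?thesis .
  qed
  show "bdd_above (sum (\<lambda>k. (\<Prod>j\<in>UNIV. (1 + real (k $ j)) powr \<alpha>) * A k) ` {F. F \<subseteq> UNIV \<and> finite F})"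
  proof (rule bdd_aboveI2)
    fix F :: "(nat ^ 'n) set" assume "F \<in> {F. F \<subseteq> UNIV \<and> finite F}"
    then have F: "finite F" by simp
    have "(\<Sum>k\<in>F. (\<Prod>j\<in>UNIV. (1 + real (k $ j)) powr \<alpha>) * A k) =
        (\<Sum>m\<in>E ` F. \<Sum>k | k \<in> F \<and> E k = m. (\<Prod>j\<in>UNIV. (1 + real (k $ j)) powr \<alpha>) * A k)"
      by (rule sum.image_gen[OF F])
    also have "\<dots> \<le> (\<Sum>m\<in>E ` F. M * G m)" by (intro sum_mono block F)
    also have "\<dots> = M * (\<Sum>m\<in>E ` F. G m)" by (simp add: sum_distrib_left)
    also have "\<dots> \<le> M * infsum G UNIV"
      using G Gpos F K by (intro mult_left_mono finite_sum_le_infsum) (auto simp: M_def)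
    finally show "(\<Sum>k\<in>F. (\<Prod>j\<in>UNIV. (1 + real (k $ j)) powr \<alpha>) * A k) \<le> M * infsum G UNIV" .
  qed
qed (use A in \<open>auto intro!: prod_nonneg mult_nonneg_nonneg\<close>)

subsection \<open>Holomorphy and the comparison of coefficients\<close>

definition complex_differentiable :: "(complex ^ 'n::finite \<Rightarrow> complex) \<Rightarrow> complex ^ 'n \<Rightarrow> bool" where
  "complex_differentiable f z \<longleftrightarrow> (\<exists>f'. (f has_derivative f') (at z) \<and> (\<forall>c v. f' (c *s v) = c * f' v))"

lemma complex_differentiable_const: "complex_differentiable (\<lambda>_. a) z"
  unfolding complex_differentiable_def by (rule exI[of _ "\<lambda>_. 0"]) simp

lemma complex_differentiable_component: "complex_differentiable (\<lambda>z. z $ j) z"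
  unfolding complex_differentiable_def
  by (rule exI[of _ "\<lambda>v. v $ j"]) (auto intro!: bounded_linear_imp_has_derivative bounded_linear_vec_nth)

lemma complex_differentiable_add:
  assumes "complex_differentiable f z" "complex_differentiable g z"
  shows "complex_differentiable (\<lambda>z. f z + g z) z"
proof -
  from assms obtain f' g' where "(f has_derivative f') (at z)" "\<And>c v. f' (c *s v) = c * f' v"
    "(g has_derivative g') (at z)" "\<And>c v. g' (c *s v) = c * g' v"
    unfolding complex_differentiable_def by blast
  then show ?thesis unfolding complex_differentiable_def
    by (intro exI[of _ "\<lambda>v. f' v + g' v"]) (auto intro!: derivative_intros simp: distrib_left)
qed

lemma complex_differentiable_mult:
  assumes "complex_differentiable f z" "complex_differentiable g z"
  shows "complex_differentiable (\<lambda>z. f z * g z) z"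
proof -
  from assms obtain f' g' where "(f has_derivative f') (at z)" "\<And>c v. f' (c *s v) = c * f' v"
    "(g has_derivative g') (at z)" "\<And>c v. g' (c *s v) = c * g' v"
    unfolding complex_differentiable_def by blast
  then show ?thesis unfolding complex_differentiable_def
    by (intro exI[of _ "\<lambda>v. f z * g' v + f' v * g z"]) (auto intro!: derivative_intros simp: algebra_simps)
qed

lemma complex_differentiable_inverse:
  assumes "complex_differentiable f z" "f z \<noteq> 0"
  shows "complex_differentiable (\<lambda>z. inverse (f z)) z"
proof -
  from assms obtain f' where "(f has_derivative f') (at z)" "\<And>c v. f' (c *s v) = c * f' v"
    unfolding complex_differentiable_def by blast
  with assms(2) show ?thesis unfolding complex_differentiable_def
    by (intro exI[of _ "\<lambda>v. - (inverse (f z) * f' v * inverse (f z))"]) (auto intro!: derivative_intros)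
qed

lemma complex_differentiable_power:
  assumes "complex_differentiable f z"
  shows "complex_differentiable (\<lambda>z. f z ^ n) z"
  by (induction n) (auto intro: complex_differentiable_const complex_differentiable_mult assms)

lemma complex_differentiable_sum:
  assumes "\<And>i. i \<in> I \<Longrightarrow> complex_differentiable (f i) z"
  shows "complex_differentiable (\<lambda>z. \<Sum>i\<in>I. f i z) z"
  using assms by (induction I rule: infinite_finite_induct)
    (auto intro: complex_differentiable_const complex_differentiable_add)

lemma complex_differentiable_prod:
  assumes "\<And>i. i \<in> I \<Longrightarrow> complex_differentiable (f i) z"
  shows "complex_differentiable (\<lambda>z. \<Prod>i\<in>I. f i z) z"
  using assms by (induction I rule: infinite_finite_induct)
    (auto intro: complex_differentiable_const complex_differentiable_mult)

lemma complex_differentiable_eval_poly: "complex_differentiable (eval_poly p) z"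
  unfolding eval_poly_def[abs_def] monom_eval_def
  by (intro complex_differentiable_sum complex_differentiable_mult complex_differentiable_const
      complex_differentiable_prod complex_differentiable_power complex_differentiable_component)

lemma holomorphic_several_quotient:
  assumes "\<And>z. z \<in> S \<Longrightarrow> eval_poly p z \<noteq> 0"
  shows "holomorphic_several (\<lambda>z. eval_poly q z / eval_poly p z) S"
  unfolding holomorphic_several_def
proof
  fix z assume "z \<in> S"
  then have "complex_differentiable (\<lambda>z. eval_poly q z * inverse (eval_poly p z)) z"
    using assms by (intro complex_differentiable_mult complex_differentiable_inverse complex_differentiable_eval_poly)
  then show "\<exists>f'. ((\<lambda>z. eval_poly q z / eval_poly p z) has_derivative f') (at z within S) \<and>
      (\<forall>c v. f' (c *s v) = c * f' v)"
    unfolding complex_differentiable_def divide_inverse using has_derivative_at_withinI by blast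
qed

lemma inverse_dist_powr_le:
  fixes z :: "complex ^ 'n::finite"
  assumes z: "z \<in> polydisc" and q: "q \<le> s / 2 * real CARD('n)"  and s: "s > 0"
  shows "dist z (\<chi> j. 1) powr (- q) \<le>
    (2 * real CARD('n)) powr (s / 2 * real CARD('n) - q) * (\<Prod>j\<in>UNIV. norm (1 - z $ j) powr (- s / 2))"
proof -
  let ?d = "dist z (\<chi> j. 1)"
  have comp: "0 < norm (1 - z $ j)" "norm (1 - z $ j) \<le> ?d" for j
  proof -
    show "0 < norm (1 - z $ j)" using z by (auto simp: polydisc_def dest: spec[of _ j])
    show "norm (1 - z $ j) \<le> ?d"
      using Finite_Cartesian_Product.norm_nth_le[where x = "z - (\<chi> j. 1)" and i = j] by (simp add: dist_norm norm_minus_commute)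
  qed
  then have d0: "?d > 0" using less_le_trans by blast
  have "?d \<le> (\<Sum>j\<in>(UNIV :: 'n set). norm ((z - (\<chi> j. 1)) $ j))"
    unfolding dist_norm norm_vec_def by (rule L2_set_le_sum) simp
  also have "\<dots> \<le> (\<Sum>j\<in>(UNIV :: 'n set). 2)"
  proof (rule sum_mono)
    fix j
    have "norm (z $ j - 1) \<le> norm (z $ j) + norm (1 :: complex)" by (rule norm_triangle_ineq4)
    also have "norm (z $ j) < 1" using z by (simp add: polydisc_def)
    finally show "norm ((z - (\<chi> j. 1)) $ j) \<le> 2" by simp
  qed
  finally have d2: "?d \<le> 2 * real CARD('n)" by simp
  have "?d powr (- q) = ?d powr (s / 2 * real CARD('n) - q) * ?d powr (- (s / 2) * real CARD('n))"
    by (simp add: powr_add[symmetric])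
  also have "\<dots> \<le> (2 * real CARD('n)) powr (s / 2 * real CARD('n) - q) * (\<Prod>j\<in>UNIV. norm (1 - z $ j) powr (- s / 2))"
  proof (rule mult_mono)
    show "?d powr (s / 2 * real CARD('n) - q) \<le> (2 * real CARD('n)) powr (s / 2 * real CARD('n) - q)"
      using d2 q by (intro powr_mono2) auto
    have "?d powr (- (s / 2) * real CARD('n)) = (?d powr (- s / 2)) ^ CARD('n)"
      by (subst powr_realpow[symmetric]) (use d0 in \<open>simp_all add: powr_powr\<close>)
    also have "\<dots> = (\<Prod>j\<in>(UNIV :: 'n set). ?d powr (- s / 2))" by simp
    also have "\<dots> \<le> (\<Prod>j\<in>UNIV. norm (1 - z $ j) powr (- s / 2))"
      using comp s by (intro prod_mono conjI powr_mono2') auto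
    finally show "?d powr (- (s / 2) * real CARD('n)) \<le> (\<Prod>j\<in>UNIV. norm (1 - z $ j) powr (- s / 2))" .
  qed auto
  finally show ?thesis .
qed

lemma weighted_coefficients_summable:
  fixes a :: "nat ^ 'n::finite \<Rightarrow> complex" and L :: real
  assumes a: "\<And>z. z \<in> polydisc \<Longrightarrow> ((\<lambda>k. a k * monom_eval k z) has_sum g z) UNIV"
    and g: "\<And>z. z \<in> polydisc \<Longrightarrow> norm (g z) \<le> L * (\<Prod>j\<in>UNIV. norm (1 - z $ j) powr (- s / 2))"
    and s: "s > 1" and \<alpha>: "\<alpha> < 0" "\<alpha> + s - 1 < 0"
  shows "(\<lambda>k. (\<Prod>j\<in>UNIV. (1 + real (k $ j)) powr \<alpha>) * (norm (a k))\<^sup>2) summable_on UNIV"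
proof -
  obtain b :: "nat \<Rightarrow> complex" and K where K: "K > 0" and
    b: "\<And>z. norm z < 1 \<Longrightarrow> (\<lambda>i. norm (b i * z ^ i)) summable_on UNIV"
    "\<And>z. norm z < 1 \<Longrightarrow> norm (infsum (\<lambda>i. b i * z ^ i) UNIV) = norm (1 - z) powr (- s / 2)"
    "\<And>r. 0 \<le> r \<Longrightarrow> r < 1 \<Longrightarrow> (\<lambda>i. (norm (b i))\<^sup>2 * r ^ (2 * i)) summable_on UNIV \<and>
       infsum (\<lambda>i. (norm (b i))\<^sup>2 * r ^ (2 * i)) UNIV \<le> K * (1 - r) powr (1 - s)"
    by (rule binomial_kernel[OF s]) (rule that)
  show ?thesis
  proof (rule summable_dyadic[where K = "L\<^sup>2 * K ^ CARD('n)" and s = s])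
    fix F :: "(nat ^ 'n) set" and r :: "real ^ 'n"
    assume F: "finite F" and "\<And>j. 0 \<le> r $ j \<and> r $ j < 1"
    then have r: "\<And>j. 0 \<le> r $ j" "\<And>j. r $ j < 1" by auto
    define u :: "complex ^ 'n \<Rightarrow> complex ^ 'n" where "u w = (\<chi> j. of_real (r $ j) * w $ j)" for w
    have u: "u w \<in> polydisc" if "\<And>j. norm (w $ j) = 1" for w
      using r that by (simp add: u_def polydisc_def norm_mult)
    have mon_u: "monom_eval k (u w) = of_real (\<Prod>j\<in>UNIV. r $ j ^ (k $ j)) * monom_eval k w" for k w
      by (simp add: u_def monom_eval_def power_mult_distrib prod.distrib)
    define R where "R k = (\<Prod>j\<in>UNIV. r $ j ^ (k $ j))" for k :: "nat ^ 'n"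
    have R0: "R k \<ge> 0" for k unfolding R_def using r by (intro prod_nonneg) auto
    have R2: "(R k)\<^sup>2 = (\<Prod>j\<in>UNIV. r $ j ^ (2 * k $ j))" for k
      unfolding R_def prod_power_distrib by (simp only: power_mult[symmetric] mult.commute)
    define B where "B k = (\<Prod>j\<in>UNIV. b (k $ j))" for k :: "nat ^ 'n"
    define a' where "a' k = a k * of_real (R k)" for k
    define b' where "b' k = of_real L * (B k * of_real (R k))" for k
    have Bk: "B k * of_real (R k) * monom_eval k w = (\<Prod>j\<in>UNIV. b (k $ j) * (u w $ j) ^ (k $ j))" for k w
      by (simp add: B_def R_def u_def monom_eval_def power_mult_distrib prod.distrib mult_ac)
    let ?one = "(\<chi> j. 1) :: complex ^ 'n"
    have one: "monom_eval k ?one = 1" for k by (simp add: monom_eval_def)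
    have u1: "norm (u w $ j) < 1" if "\<And>j. norm (w $ j) = 1" for w j
      using u[OF that] by (simp add: polydisc_def)
    have "(\<Sum>k\<in>F. (norm (a' k))\<^sup>2) \<le> infsum (\<lambda>k. (norm (b' k))\<^sup>2) UNIV"
    proof (rule parseval_mono[OF _ _ _ F])
      have "(\<lambda>k. a k * monom_eval k (u ?one)) summable_on UNIV"
        using a[OF u[of ?one]] by (auto simp: summable_on_def)
      then show "(\<lambda>k. norm (a' k)) summable_on UNIV"
        by (simp add: summable_on_iff_abs_summable_on_complex mon_u one a'_def R_def)
      have "(\<lambda>k. norm (\<Prod>j\<in>UNIV. b (k $ j) * (u ?one $ j) ^ (k $ j))) summable_on UNIV"
        by (rule abs_summable_prod) (rule b, rule u1, simp)
      then show "(\<lambda>k. norm (b' k)) summable_on UNIV"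
        using summable_on_cmult_right[of "\<lambda>k. norm (B k * of_real (R k))" UNIV "\<bar>L\<bar>"]
        unfolding Bk[symmetric] one by (simp add: b'_def norm_mult)
      fix w :: "complex ^ 'n" assume w: "\<And>j. norm (w $ j) = 1"
      have "infsum (\<lambda>k. a' k * monom_eval k w) UNIV = g (u w)"
        using a[OF u[OF w]] by (intro infsumI) (simp add: a'_def mon_u R_def mult.assoc)
      moreover have "infsum (\<lambda>k. b' k * monom_eval k w) UNIV =
          of_real L * infsum (\<lambda>k. \<Prod>j\<in>UNIV. b (k $ j) * (u w $ j) ^ (k $ j)) UNIV"
        unfolding Bk[symmetric] by (simp add: b'_def mult.assoc infsum_cmult_right')
      moreover have "\<dots> = of_real L * (\<Prod>j\<in>UNIV. infsum (\<lambda>i. b i * (u w $ j) ^ i) UNIV)"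
        by (subst infsum_prod) (auto intro!: b(1) u1 w)
      moreover have "norm \<dots> = \<bar>L\<bar> * (\<Prod>j\<in>UNIV. norm (1 - u w $ j) powr (- s / 2))"
        using b(2)[OF u1[OF w]] by (simp add: norm_mult prod_norm[symmetric])
      moreover have "L * (\<Prod>j\<in>UNIV. norm (1 - u w $ j) powr (- s / 2)) \<le>
          \<bar>L\<bar> * (\<Prod>j\<in>UNIV. norm (1 - u w $ j) powr (- s / 2))"
        by (intro mult_right_mono prod_nonneg) auto
      ultimately show "norm (infsum (\<lambda>k. a' k * monom_eval k w) UNIV) \<le> norm (infsum (\<lambda>k. b' k * monom_eval k w) UNIV)"
        using g[OF u[OF w]] by simp
    qed
    also have "(\<lambda>k. (norm (b' k))\<^sup>2) = (\<lambda>k. L\<^sup>2 * (\<Prod>j\<in>UNIV. (norm (b (k $ j)))\<^sup>2 * r $ j ^ (2 * k $ j)))"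
      by (simp add: b'_def norm_mult power_mult_distrib R2 B_def prod_norm[symmetric] prod_power_distrib prod.distrib)
    also have "infsum \<dots> UNIV = L\<^sup>2 * (\<Prod>j\<in>UNIV. infsum (\<lambda>i. (norm (b i))\<^sup>2 * r $ j ^ (2 * i)) UNIV)"
      using b(3) r by (subst infsum_cmult_right', subst infsum_prod) (auto simp: abs_mult)
    also have "\<dots> \<le> L\<^sup>2 * (\<Prod>j\<in>UNIV. K * (1 - r $ j) powr (1 - s))"
      using b(3) r by (intro mult_left_mono prod_mono conjI infsum_nonneg) auto
    also have "\<dots> = L\<^sup>2 * K ^ CARD('n) * (\<Prod>j\<in>UNIV. (1 - r $ j) powr (1 - s))"
      by (simp add: prod.distrib)
    finally show "(\<Sum>k\<in>F. (norm (a k))\<^sup>2 * (\<Prod>j\<in>UNIV. r $ j ^ (2 * k $ j))) \<le>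
        L\<^sup>2 * K ^ CARD('n) * (\<Prod>j\<in>UNIV. (1 - r $ j) powr (1 - s))"
      by (simp add: a'_def norm_mult power_mult_distrib R2)
  qed (use \<alpha> K in auto)
qed

lemma prod_powr_le_tdeg:
  fixes k :: "nat ^ 'n::finite"
  shows "(\<Prod>j\<in>UNIV. (1 + real (k $ j)) powr (\<alpha> + 2 / real CARD('n))) \<le>
    (\<Prod>j\<in>UNIV. (1 + real (k $ j)) powr \<alpha>) * (1 + real (tdeg k))\<^sup>2"
proof -
  have "(1 + real (k $ j)) powr (2 / real CARD('n)) \<le> (1 + real (tdeg k)) powr (2 / real CARD('n))" for j
    by (intro powr_mono2) (auto simp: tdeg_def intro!: member_le_sum)
  then have "(\<Prod>j\<in>UNIV. (1 + real (k $ j)) powr (2 / real CARD('n))) \<le>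
      (\<Prod>j\<in>(UNIV :: 'n set). (1 + real (tdeg k)) powr (2 / real CARD('n)))"
    by (intro prod_mono) auto
  also have "\<dots> = ((1 + real (tdeg k)) powr (2 / real CARD('n))) powr real CARD('n)"
    by (simp add: powr_realpow)
  also have "\<dots> = (1 + real (tdeg k))\<^sup>2"
    by (simp add: powr_powr)
  finally have "(\<Prod>j\<in>UNIV. (1 + real (k $ j)) powr (2 / real CARD('n))) \<le> (1 + real (tdeg k))\<^sup>2" .
  then have "(\<Prod>j\<in>UNIV. (1 + real (k $ j)) powr \<alpha>) * (\<Prod>j\<in>UNIV. (1 + real (k $ j)) powr (2 / real CARD('n))) \<le>
      (\<Prod>j\<in>UNIV. (1 + real (k $ j)) powr \<alpha>) * (1 + real (tdeg k))\<^sup>2"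
    by (intro mult_left_mono prod_nonneg) auto
  then show ?thesis by (simp add: powr_add prod.distrib)
qed

theorem theorem3:
  fixes p :: "'n::finite mpoly" and \<alpha> q C :: real
  assumes "\<alpha> < 0"
    and "atoral p"
    and "\<And>z. z \<in> polydisc \<Longrightarrow> eval_poly p z \<noteq> 0"
    and "{z \<in> frontier polydisc. eval_poly p z = 0} = {\<chi> j. 1}"
    and "q < (1 - \<alpha>) / 2 * real CARD('n)"
    and "C > 0"
    and "\<And>z. z \<in> polydisc \<Longrightarrow> norm (eval_poly p z) \<ge> C * dist z (\<chi> j. 1) powr q"
  shows "(\<lambda>z. eval_poly (reflection p) z / eval_poly p z) \<in> dirichlet_space (\<alpha> + 2 / real CARD('n))"
proof -
  have refl_le: "norm (eval_poly (reflection p) z) \<le> norm (eval_poly p z)" if "z \<in> polydisc" for z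
    by (rule norm_reflection_le[OF _ that]) (rule assms(3))
  obtain c :: "nat ^ 'n \<Rightarrow> complex" and g K where
    c: "\<And>z. z \<in> polydisc \<Longrightarrow> ((\<lambda>k. c k * monom_eval k z) has_sum (eval_poly (reflection p) z / eval_poly p z)) UNIV"
    and g: "\<And>z. z \<in> polydisc \<Longrightarrow> ((\<lambda>k. (1 + of_nat (tdeg k)) * c k * monom_eval k z) has_sum g z) UNIV"
    and K: "\<And>z. z \<in> polydisc \<Longrightarrow> norm (g z) \<le> K / norm (eval_poly p z)"
  proof (rule quotient_power_series[of p "reflection p"])
    show "eval_poly p z \<noteq> 0" "norm (eval_poly (reflection p) z) \<le> norm (eval_poly p z)"
      if "z \<in> polydisc" for z
      using that by (rule assms(3), rule refl_le)
  qed (rule that)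
  have "2 * q / real CARD('n) < 1 - \<alpha>" using assms(5) by (simp add: field_simps)
  then obtain s where s: "max 1 (2 * q / real CARD('n)) < s" "s < 1 - \<alpha>"
    using dense[of "max 1 (2 * q / real CARD('n))" "1 - \<alpha>"] assms(1) by auto
  then have q: "q \<le> s / 2 * real CARD('n)" by (simp add: field_simps)
  have nonneg: "K \<ge> 0"
    using order_trans[OF norm_ge_zero K[OF zero_in_polydisc]] assms(3)[OF zero_in_polydisc]
    by (simp add: zero_le_divide_iff)
  let ?L = "K / C * (2 * real CARD('n)) powr (s / 2 * real CARD('n) - q)"
  have "norm (g z) \<le> ?L * (\<Prod>j\<in>UNIV. norm (1 - z $ j) powr (- s / 2))" if z: "z \<in> polydisc" for z
  proof -
    have "z \<noteq> (\<chi> j. 1)" using z by (auto simp: polydisc_def)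
    then have d: "dist z (\<chi> j. 1) powr q > 0" by simp
    have "norm (g z) \<le> K / norm (eval_poly p z)" by (rule K[OF z])
    also have "\<dots> \<le> K / (C * dist z (\<chi> j. 1) powr q)"
      using assms(6) d nonneg by (intro divide_left_mono assms(7)[OF z] mult_pos_pos) (use assms(3)[OF z] in auto)
    also have "\<dots> = K / C * dist z (\<chi> j. 1) powr (- q)"
      by (simp add: powr_minus divide_inverse)
    also have "\<dots> \<le> K / C * ((2 * real CARD('n)) powr (s / 2 * real CARD('n) - q) * (\<Prod>j\<in>UNIV. norm (1 - z $ j) powr (- s / 2)))"
      using z q s nonneg assms(6) by (intro mult_left_mono inverse_dist_powr_le) auto
    finally show ?thesis by (simp add: mult.assoc)
  qed
  from weighted_coefficients_summable[OF g this] s assms(1)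
  have summ: "(\<lambda>k. (\<Prod>j\<in>UNIV. (1 + real (k $ j)) powr \<alpha>) * (norm ((1 + of_nat (tdeg k)) * c k))\<^sup>2) summable_on UNIV"
    by simp
  have "norm (1 + of_nat n :: complex) = 1 + real n" for n
    by (metis norm_of_nat of_nat_Suc)
  then have "(\<Prod>j\<in>UNIV. (1 + real (k $ j)) powr (\<alpha> + 2 / real CARD('n))) * (norm (c k))\<^sup>2 \<le>
      (\<Prod>j\<in>UNIV. (1 + real (k $ j)) powr \<alpha>) * (norm ((1 + of_nat (tdeg k)) * c k))\<^sup>2" for k
    using mult_right_mono[OF prod_powr_le_tdeg[of k \<alpha>], of "(norm (c k))\<^sup>2"]
    by (simp add: norm_mult power_mult_distrib mult.assoc)
  then have "(\<lambda>k. (\<Prod>j\<in>UNIV. (1 + real (k $ j)) powr (\<alpha> + 2 / real CARD('n))) * (norm (c k))\<^sup>2) summable_on UNIV"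
    by (intro summable_on_comparison_test[OF summ]) (auto intro!: mult_nonneg_nonneg prod_nonneg)
  with c show ?thesis
    unfolding dirichlet_space_def using holomorphic_several_quotient[OF assms(3)] by blast
qed

end
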